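(* Let $A$ be a unitarizable Hopf $*$-algebra and $Z$ an $A$-$*$-Galois extension with a positive Haar measure. Then $Z$ admits a $C^*$-norm. Moreover, the supremum of all $C^*$-seminorms on $Z$ is finite at every element and is a $C^*$-norm on $Z$.
   Context: Base field $\mathbb C$. A Hopf $*$-algebra is a Hopf algebra that is a $*$-algebra with $\Delta$ a $*$-homomorphism; unitarizable means every finite-dimensional right comodule $V$ admits a scalar product $\phi_V:\overline V\otimes V\to\mathbb C$ that is a comodule map ($\overline V$ the conjugate comodule, $\overline v\mapsto\sum\overline{v_i}\otimes a_i^*$ if $\alpha_V(v)=\sum v_i\otimes a_i$). An $A$-$*$-Galois extension is a nonzero $*$-algebra $Z$ with a left coaction $\alpha_Z:Z\to A\otimes Z$ that is a $*$-homomorphism and with $(1_A\otimes m_Z)(\alpha_Z\otimes 1_Z):Z\otimes Z\to A\otimes Z$ bijective. A Haar measure on $Z$: linear $\mu$ with $(1_A\otimes\mu)\alpha_Z=\mu(\cdot)1_A$, $\mu(1)=1$; positive if $\mu(z^*z)\ge0$. A $C^*$-seminorm on a $*$-algebra is a submultiplicative seminorm $p$ with $p(x^*x)=p(x)^2$. *)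

theory Defs
  imports "HOL-Analysis.Analysis" "HOL-Library.Function_Algebras"
begin

class cvec = ab_group_add +
  fixes scaleC :: "complex \<Rightarrow> 'a \<Rightarrow> 'a" (infixr "*\<^sub>C" 75)
  assumes scaleC_add_right: "c *\<^sub>C (x + y) = c *\<^sub>C x + c *\<^sub>C y"
    and scaleC_add_left: "(b + c) *\<^sub>C x = b *\<^sub>C x + c *\<^sub>C x"
    and scaleC_scaleC: "b *\<^sub>C (c *\<^sub>C x) = (b * c) *\<^sub>C x"
    and scaleC_one: "1 *\<^sub>C x = x"

class calg = cvec + ring_1 +
  assumes mult_scaleC_left: "(c *\<^sub>C x) * y = c *\<^sub>C (x * y)"
    and mult_scaleC_right: "x * (c *\<^sub>C y) = c *\<^sub>C (x * y)"

class star_alg = calg +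
  fixes star :: "'a \<Rightarrow> 'a"
  assumes star_star: "star (star x) = x"
    and star_add: "star (x + y) = star x + star y"
    and star_scaleC: "star (c *\<^sub>C x) = cnj c *\<^sub>C star x"
    and star_mult: "star (x * y) = star y * star x"

instantiation complex :: cvec
begin
definition scaleC_complex :: "complex \<Rightarrow> complex \<Rightarrow> complex" where
  "scaleC_complex c x = c * x"
instance by standard (auto simp: scaleC_complex_def algebra_simps)
end

instantiation "fun" :: (type, cvec) cvec
begin
definition scaleC_fun :: "complex \<Rightarrow> ('a \<Rightarrow> 'b) \<Rightarrow> 'a \<Rightarrow> 'b" where
  "scaleC_fun c f = (\<lambda>i. c *\<^sub>C f i)"
instance by standard
  (auto simp: scaleC_fun_def plus_fun_def scaleC_add_right scaleC_add_left scaleC_scaleC scaleC_one)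
end

definition clinear_fun :: "('v::cvec \<Rightarrow> complex) \<Rightarrow> bool" where
  "clinear_fun f \<longleftrightarrow> (\<forall>x y. f (x + y) = f x + f y) \<and> (\<forall>c x. f (c *\<^sub>C x) = c * f x)"

text \<open>A list of pairs [(v1,w1),...] represents the tensor \<Sum> vi \<otimes> wi in the
algebraic tensor product over \<complex>.  Two such lists represent the same tensor iff they
agree against all products of linear functionals (this separates points of V \<otimes> W).\<close>

definition teq :: "('v::cvec \<times> 'w::cvec) list \<Rightarrow> ('v \<times> 'w) list \<Rightarrow> bool" where
  "teq xs ys \<longleftrightarrow> (\<forall>f g. clinear_fun f \<longrightarrow> clinear_fun g \<longrightarrow>
      (\<Sum>(v, w)\<leftarrow>xs. f v * g w) = (\<Sum>(v, w)\<leftarrow>ys. f v * g w))"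

definition teq3 :: "('u::cvec \<times> 'v::cvec \<times> 'w::cvec) list \<Rightarrow> ('u \<times> 'v \<times> 'w) list \<Rightarrow> bool" where
  "teq3 xs ys \<longleftrightarrow> (\<forall>f g h. clinear_fun f \<longrightarrow> clinear_fun g \<longrightarrow> clinear_fun h \<longrightarrow>
      (\<Sum>(u, v, w)\<leftarrow>xs. f u * g v * h w) = (\<Sum>(u, v, w)\<leftarrow>ys. f u * g v * h w))"

definition tmul :: "('a::times \<times> 'b::times) list \<Rightarrow> ('a \<times> 'b) list \<Rightarrow> ('a \<times> 'b) list" where
  "tmul xs ys = [(a * a', b * b'). (a, b) \<leftarrow> xs, (a', b') \<leftarrow> ys]"

definition tensor_star_hom :: "('z::star_alg \<Rightarrow> ('a::star_alg \<times> 'b::star_alg) list) \<Rightarrow> bool" where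
  "tensor_star_hom F \<longleftrightarrow>
     (\<forall>x y. teq (F (x + y)) (F x @ F y)) \<and>
     (\<forall>c x. teq (F (c *\<^sub>C x)) (map (\<lambda>(a, b). (c *\<^sub>C a, b)) (F x))) \<and>
     (\<forall>x y. teq (F (x * y)) (tmul (F x) (F y))) \<and>
     teq (F 1) [(1, 1)] \<and>
     (\<forall>x. teq (F (star x)) (map (\<lambda>(a, b). (star a, star b)) (F x)))"

definition hopf_star_algebra ::
  "('a::star_alg \<Rightarrow> ('a \<times> 'a) list) \<Rightarrow> ('a \<Rightarrow> complex) \<Rightarrow> ('a \<Rightarrow> 'a) \<Rightarrow> bool" where
  "hopf_star_algebra \<Delta> \<epsilon> S \<longleftrightarrow>
     tensor_star_hom \<Delta> \<and>
     (\<forall>x. teq3 (concat [map (\<lambda>(p, q). (p, q, v)) (\<Delta> u). (u, v) \<leftarrow> \<Delta> x])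
                (concat [map (\<lambda>(p, q). (u, p, q)) (\<Delta> v). (u, v) \<leftarrow> \<Delta> x])) \<and>
     clinear_fun \<epsilon> \<and> (\<forall>x y. \<epsilon> (x * y) = \<epsilon> x * \<epsilon> y) \<and> \<epsilon> 1 = 1 \<and>
     (\<forall>x. (\<Sum>(u, v)\<leftarrow>\<Delta> x. \<epsilon> u *\<^sub>C v) = x) \<and>
     (\<forall>x. (\<Sum>(u, v)\<leftarrow>\<Delta> x. \<epsilon> v *\<^sub>C u) = x) \<and>
     (\<forall>x y. S (x + y) = S x + S y) \<and> (\<forall>c x. S (c *\<^sub>C x) = c *\<^sub>C S x) \<and>
     (\<forall>x. (\<Sum>(u, v)\<leftarrow>\<Delta> x. S u * v) = \<epsilon> x *\<^sub>C 1) \<and>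
     (\<forall>x. (\<Sum>(u, v)\<leftarrow>\<Delta> x. u * S v) = \<epsilon> x *\<^sub>C 1)"

text \<open>Every finite-dimensional comodule is isomorphic to one whose underlying space is
  \<complex>^n, realised as cspace n = {v :: nat \<Rightarrow> complex. v vanishes outside {..<n}}.\<close>
definition cspace :: "nat \<Rightarrow> (nat \<Rightarrow> complex) set" where
  "cspace n = {v. \<forall>i\<ge>n. v i = 0}"

definition right_comodule ::
  "('a::star_alg \<Rightarrow> ('a \<times> 'a) list) \<Rightarrow> ('a \<Rightarrow> complex) \<Rightarrow> nat
     \<Rightarrow> ((nat \<Rightarrow> complex) \<Rightarrow> ((nat \<Rightarrow> complex) \<times> 'a) list) \<Rightarrow> bool" where
  "right_comodule \<Delta> \<epsilon> n \<alpha> \<longleftrightarrow>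
     (\<forall>v\<in>cspace n. fst ` set (\<alpha> v) \<subseteq> cspace n) \<and>
     (\<forall>v\<in>cspace n. \<forall>w\<in>cspace n. teq (\<alpha> (v + w)) (\<alpha> v @ \<alpha> w)) \<and>
     (\<forall>c. \<forall>v\<in>cspace n. teq (\<alpha> (c *\<^sub>C v)) (map (\<lambda>(u, a). (c *\<^sub>C u, a)) (\<alpha> v))) \<and>
     (\<forall>v\<in>cspace n. teq3 (concat [map (\<lambda>(w, b). (w, b, a)) (\<alpha> u). (u, a) \<leftarrow> \<alpha> v])
                         (concat [map (\<lambda>(p, q). (u, p, q)) (\<Delta> a). (u, a) \<leftarrow> \<alpha> v])) \<and>
     (\<forall>v\<in>cspace n. (\<Sum>(u, a)\<leftarrow>\<alpha> v. \<epsilon> a *\<^sub>C u) = v)"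

text \<open>A scalar product on the comodule (a positive definite Hermitian form, conjugate-linear
  in the first variable, i.e. linear on the conjugate space) which is a comodule map
  from the tensor product comodule conj V \<otimes> V to the trivial comodule \<complex>.\<close>
definition invariant_scalar_product ::
  "nat \<Rightarrow> ((nat \<Rightarrow> complex) \<Rightarrow> ((nat \<Rightarrow> complex) \<times> 'a::star_alg) list)
     \<Rightarrow> ((nat \<Rightarrow> complex) \<Rightarrow> (nat \<Rightarrow> complex) \<Rightarrow> complex) \<Rightarrow> bool" where
  "invariant_scalar_product n \<alpha> \<phi> \<longleftrightarrow>
     (\<forall>u\<in>cspace n. \<forall>v\<in>cspace n. \<forall>w\<in>cspace n. \<phi> u (v + w) = \<phi> u v + \<phi> u w) \<and>
     (\<forall>c. \<forall>u\<in>cspace n. \<forall>v\<in>cspace n. \<phi> u (c *\<^sub>C v) = c * \<phi> u v) \<and>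
     (\<forall>u\<in>cspace n. \<forall>v\<in>cspace n. \<phi> v u = cnj (\<phi> u v)) \<and>
     (\<forall>v\<in>cspace n. v \<noteq> 0 \<longrightarrow> Im (\<phi> v v) = 0 \<and> Re (\<phi> v v) > 0) \<and>
     (\<forall>v\<in>cspace n. \<forall>w\<in>cspace n.
        (\<Sum>(v', a)\<leftarrow>\<alpha> v. \<Sum>(w', b)\<leftarrow>\<alpha> w. \<phi> v' w' *\<^sub>C (star a * b)) = \<phi> v w *\<^sub>C 1)"

definition unitarizable :: "('a::star_alg \<Rightarrow> ('a \<times> 'a) list) \<Rightarrow> ('a \<Rightarrow> complex) \<Rightarrow> bool" where
  "unitarizable \<Delta> \<epsilon> \<longleftrightarrow>
     (\<forall>n \<alpha>. right_comodule \<Delta> \<epsilon> n \<alpha> \<longrightarrow> (\<exists>\<phi>. invariant_scalar_product n \<alpha> \<phi>))"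

definition left_coaction ::
  "('a::star_alg \<Rightarrow> ('a \<times> 'a) list) \<Rightarrow> ('a \<Rightarrow> complex) \<Rightarrow> ('z::star_alg \<Rightarrow> ('a \<times> 'z) list) \<Rightarrow> bool" where
  "left_coaction \<Delta> \<epsilon> \<alpha> \<longleftrightarrow>
     (\<forall>z. teq3 (concat [map (\<lambda>(p, q). (p, q, y)) (\<Delta> a). (a, y) \<leftarrow> \<alpha> z])
                (concat [map (\<lambda>(b, x). (a, b, x)) (\<alpha> y). (a, y) \<leftarrow> \<alpha> z])) \<and>
     (\<forall>z. (\<Sum>(a, y)\<leftarrow>\<alpha> z. \<epsilon> a *\<^sub>C y) = z)"

definition galois_map :: "('z::star_alg \<Rightarrow> ('a::star_alg \<times> 'z) list) \<Rightarrow> ('z \<times> 'z) list \<Rightarrow> ('a \<times> 'z) list" where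
  "galois_map \<alpha> xs = concat [map (\<lambda>(a, y). (a, y * w)) (\<alpha> z). (z, w) \<leftarrow> xs]"

definition star_galois_extension ::
  "('a::star_alg \<Rightarrow> ('a \<times> 'a) list) \<Rightarrow> ('a \<Rightarrow> complex) \<Rightarrow> ('z::star_alg \<Rightarrow> ('a \<times> 'z) list) \<Rightarrow> bool" where
  "star_galois_extension \<Delta> \<epsilon> \<alpha> \<longleftrightarrow>
     (\<exists>z::'z. z \<noteq> 0) \<and>
     left_coaction \<Delta> \<epsilon> \<alpha> \<and> tensor_star_hom \<alpha> \<and>
     (\<forall>t. \<exists>s. teq (galois_map \<alpha> s) t) \<and>
     (\<forall>s s'. teq (galois_map \<alpha> s) (galois_map \<alpha> s') \<longrightarrow> teq s s')"

definition haar_measure :: "('z::star_alg \<Rightarrow> ('a::star_alg \<times> 'z) list) \<Rightarrow> ('z \<Rightarrow> complex) \<Rightarrow> bool" where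
  "haar_measure \<alpha> \<mu> \<longleftrightarrow> clinear_fun \<mu> \<and>
     (\<forall>z. (\<Sum>(a, y)\<leftarrow>\<alpha> z. \<mu> y *\<^sub>C a) = \<mu> z *\<^sub>C (1::'a)) \<and> \<mu> 1 = 1"

definition positive_functional :: "('z::star_alg \<Rightarrow> complex) \<Rightarrow> bool" where
  "positive_functional \<mu> \<longleftrightarrow> (\<forall>z. Im (\<mu> (star z * z)) = 0 \<and> Re (\<mu> (star z * z)) \<ge> 0)"

definition cstar_seminorm :: "('z::star_alg \<Rightarrow> real) \<Rightarrow> bool" where
  "cstar_seminorm p \<longleftrightarrow>
     (\<forall>x y. p (x + y) \<le> p x + p y) \<and> (\<forall>c x. p (c *\<^sub>C x) = cmod c * p x) \<and>
     (\<forall>x y. p (x * y) \<le> p x * p y) \<and> (\<forall>x. p (star x * x) = (p x)\<^sup>2)"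

definition cstar_norm :: "('z::star_alg \<Rightarrow> real) \<Rightarrow> bool" where
  "cstar_norm p \<longleftrightarrow> cstar_seminorm p \<and> (\<forall>x. p x = 0 \<longrightarrow> x = 0)"

end

theory Submission
  imports Defs
begin

text \<open>Every \<open>z\<close> lies in a finite-dimensional subcomodule of \<open>Z\<close> with basis \<open>e\<^sub>i\<close>.  An invariant
  scalar product \<open>F\<close> on the corresponding right comodule makes \<open>\<Sum>F\<^sub>i\<^sub>j e\<^sub>i\<^sup>* e\<^sub>j\<close> coinvariant, hence a
  scalar \<open>c\<close> because the Galois map is injective; completing squares in \<open>F\<close> rewrites this as
  \<open>\<Sum>y\<^sub>k\<^sup>* y\<^sub>k = c\<close> with \<open>z\<close> in the span of the \<open>y\<^sub>k\<close>.

  This bounds left multiplication by \<open>z\<close> in the GNS representation of \<open>\<mu>\<close>, and the resulting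
  operator seminorm is a norm because \<open>\<mu>\<close> is faithful: by strong invariance its null space is a
  subcomodule and a left ideal, and surjectivity of the Galois map then forces it to vanish.

  It also bounds \<open>p z\<close> for every C*-seminorm \<open>p\<close>, because \<open>p (y\<^sub>k)\<^sup>2 \<le> p (\<Sum>y\<^sub>j\<^sup>* y\<^sub>j)\<close>.  Since
  \<open>Z\<close> is not complete for \<open>p\<close>, the positivity of \<open>y\<^sup>* y\<close> that this needs is proved by Kaplansky's
  argument with polynomial approximations in place of square roots.\<close>

section \<open>Linear maps and tensors\<close>

global_interpretation cvs: vector_space "scaleC :: complex \<Rightarrow> 'v \<Rightarrow> 'v::cvec"
  by standard (simp_all add: scaleC_add_right scaleC_add_left scaleC_scaleC scaleC_one)

global_interpretation cvs: vector_space_pair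
  "scaleC :: complex \<Rightarrow> 'v \<Rightarrow> 'v::cvec" "scaleC :: complex \<Rightarrow> 'w \<Rightarrow> 'w::cvec" ..

abbreviation clinear :: "('v::cvec \<Rightarrow> 'w::cvec) \<Rightarrow> bool" where
  "clinear \<equiv> Vector_Spaces.linear scaleC scaleC"

lemma clinear_iff: "clinear f \<longleftrightarrow> (\<forall>x y. f (x + y) = f x + f y) \<and> (\<forall>c x. f (c *\<^sub>C x) = c *\<^sub>C f x)"
  by (simp add: Vector_Spaces.linear_iff cvs.vector_space_axioms)

lemma clinearI:
  assumes "\<And>x y. f (x + y) = f x + f y" "\<And>c x. f (c *\<^sub>C x) = c *\<^sub>C f x"
  shows "clinear f"
  using assms by (simp add: clinear_iff)

lemma scaleC_complex: "(*\<^sub>C) = ((*) :: complex \<Rightarrow> complex \<Rightarrow> complex)"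
  by (simp add: fun_eq_iff scaleC_complex_def)

lemma clinear_fun_iff_clinear: "clinear_fun f \<longleftrightarrow> clinear f"
  by (simp add: clinear_fun_def clinear_iff scaleC_complex_def)

lemma clinear_sum_list: "clinear f \<Longrightarrow> f (\<Sum>x\<leftarrow>xs. g x) = (\<Sum>x\<leftarrow>xs. f (g x))"
  by (induction xs) (simp_all add: cvs.linear_0 cvs.linear_add)

lemma scaleC_sum_list: "c *\<^sub>C (\<Sum>x\<leftarrow>xs. g x) = (\<Sum>x\<leftarrow>xs. c *\<^sub>C g x)"
  using clinear_sum_list[OF cvs.linear_scale_self] .

lemma sum_list_scaleC: "(\<Sum>x\<leftarrow>xs. g x) *\<^sub>C v = (\<Sum>x\<leftarrow>xs. g x *\<^sub>C v)"
  by (induction xs) (simp_all add: scaleC_add_left)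

lemma clinear_compose: "clinear f \<Longrightarrow> clinear g \<Longrightarrow> clinear (\<lambda>x. f (g x))"
  by (simp add: clinear_iff)

lemma clinear_add: "clinear f \<Longrightarrow> clinear g \<Longrightarrow> clinear (\<lambda>x. f x + g x)"
  by (simp add: clinear_iff scaleC_add_right)

lemma clinear_scaleC_right: "clinear f \<Longrightarrow> clinear (\<lambda>x. c *\<^sub>C f x)"
  by (simp add: clinear_iff scaleC_add_right scaleC_scaleC mult.commute)

lemma clinear_scaleC_left: "clinear f \<Longrightarrow> clinear (\<lambda>x. f x *\<^sub>C v)"
  for f :: "'u::cvec \<Rightarrow> complex" and v :: "'v::cvec"
  by (simp add: clinear_iff scaleC_add_left scaleC_scaleC scaleC_complex_def)

lemma clinear_mult_left: "clinear f \<Longrightarrow> clinear (\<lambda>x. b * f x)" for b :: "'b::calg"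
  by (simp add: clinear_iff distrib_left mult_scaleC_right)

lemma clinear_mult_right: "clinear f \<Longrightarrow> clinear (\<lambda>x. f x * b)" for b :: "'b::calg"
  by (simp add: clinear_iff distrib_right mult_scaleC_left)

lemma clinear_sum: "(\<And>i. clinear (\<lambda>x. f x i)) \<Longrightarrow> clinear (\<lambda>x. \<Sum>i\<in>I. f x i)"
  by (simp add: clinear_iff sum.distrib cvs.scale_sum_right)

lemma clinear_sum_list_fun: "(\<And>i. clinear (\<lambda>x. f x i)) \<Longrightarrow> clinear (\<lambda>x. \<Sum>i\<leftarrow>is. f x i)"
  by (induction "is") (simp_all add: clinear_add cvs.linear_zero)

lemma coordinate_functionals:
  fixes B :: "'v::cvec set"
  assumes "cvs.independent B" "finite B"
  obtains f where "\<And>b. clinear (f b :: 'v \<Rightarrow> complex)"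
    "\<And>b c. b \<in> B \<Longrightarrow> c \<in> B \<Longrightarrow> f b c = of_bool (b = c)"
    "\<And>v. v \<in> cvs.span B \<Longrightarrow> (\<Sum>b\<in>B. f b v *\<^sub>C b) = v"
proof -
  define E where "E = cvs.extend_basis B"
  have E: "cvs.independent E" "B \<subseteq> E" "cvs.span E = UNIV"
    using assms by (simp_all add: E_def cvs.independent_extend_basis cvs.extend_basis_superset)
  show ?thesis
  proof (rule that[of "\<lambda>b v. cvs.representation E v b"])
    show "clinear (\<lambda>v. cvs.representation E v b)" for b
      unfolding scaleC_complex by (rule cvs.linear_representation[OF E(1,3)])
    show "cvs.representation E c b = of_bool (b = c)" if "b \<in> B" "c \<in> B" for b c
      using cvs.representation_basis[OF E(1), of c] that E(2) by auto
    show "(\<Sum>b\<in>B. cvs.representation E v b *\<^sub>C b) = v" if "v \<in> cvs.span B" for v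
      using cvs.sum_representation_eq[OF assms(1) that assms(2)]
      by (simp add: cvs.representation_extend[OF E(1) that E(2)])
  qed
qed

lemma clinear_functionals_separate:
  assumes "\<And>f :: 'v::cvec \<Rightarrow> complex. clinear f \<Longrightarrow> f x = f y"
  shows "x = y"
proof (rule ccontr)
  assume "x \<noteq> y"
  then have "cvs.independent {x - y}" "finite {x - y}" by simp_all
  then obtain f where f: "\<And>b. clinear (f b :: 'v \<Rightarrow> complex)"
    "\<And>b c. b \<in> {x - y} \<Longrightarrow> c \<in> {x - y} \<Longrightarrow> f b c = of_bool (b = c)"
    by (rule coordinate_functionals) blast
  have "f (x - y) (x - y) = 0" using assms[OF f(1)] by (simp add: cvs.linear_diff[OF f(1)])
  with f(2)[of "x - y" "x - y"] show False by simp
qed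

lemma finite_coordinates:
  fixes X :: "'v::cvec set"
  assumes "finite X"
  obtains E f where "finite E" "\<And>e. clinear (f e :: 'v \<Rightarrow> complex)"
    "\<And>v. v \<in> X \<Longrightarrow> (\<Sum>e\<in>E. f e v *\<^sub>C e) = v"
proof -
  obtain E where E: "E \<subseteq> X" "cvs.independent E" "X \<subseteq> cvs.span E"
    by (rule cvs.maximal_independent_subset)
  then have "finite E" using assms finite_subset by blast
  with E(2) obtain f where "\<And>e. clinear (f e :: 'v \<Rightarrow> complex)"
    "\<And>v. v \<in> cvs.span E \<Longrightarrow> (\<Sum>e\<in>E. f e v *\<^sub>C e) = v"
    by (rule coordinate_functionals) blast
  with \<open>finite E\<close> E(3) show ?thesis by (intro that[of E f]) auto
qed

definition cbilinear :: "('u::cvec \<Rightarrow> 'v::cvec \<Rightarrow> 'w::cvec) \<Rightarrow> bool" where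
  "cbilinear B \<longleftrightarrow> (\<forall>v. clinear (B v)) \<and> (\<forall>w. clinear (\<lambda>v. B v w))"

lemma cbilinearI: "(\<And>v. clinear (B v)) \<Longrightarrow> (\<And>w. clinear (\<lambda>v. B v w)) \<Longrightarrow> cbilinear B"
  by (simp add: cbilinear_def)

lemma cbilinear_right: "cbilinear B \<Longrightarrow> clinear (B v)"
  and cbilinear_left: "cbilinear B \<Longrightarrow> clinear (\<lambda>v. B v w)"
  by (simp_all add: cbilinear_def)

lemma cbilinear_mult: "clinear f \<Longrightarrow> clinear g \<Longrightarrow> cbilinear (\<lambda>x y. f x * (g y :: 'b::calg))"
  by (intro cbilinearI clinear_mult_left clinear_mult_right)

lemma cbilinear_scaleC: "clinear f \<Longrightarrow> clinear g \<Longrightarrow> cbilinear (\<lambda>x y. f x *\<^sub>C g y)"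
  by (intro cbilinearI clinear_scaleC_left clinear_scaleC_right)

lemma cbilinear_flip: "cbilinear B \<Longrightarrow> cbilinear (\<lambda>x y. B y x)"
  by (simp add: cbilinear_def)

lemma cbilinear_compose:
  assumes "cbilinear B" "clinear f" "clinear g"
  shows "cbilinear (\<lambda>x y. B (f x) (g y))"
  using assms by (simp add: cbilinear_def clinear_iff)

lemma cbilinear_sum: "(\<And>i. cbilinear (\<lambda>x y. B x y i)) \<Longrightarrow> cbilinear (\<lambda>x y. \<Sum>i\<in>I. B x y i)"
  by (intro cbilinearI clinear_sum) (simp_all add: cbilinear_def)

lemma teq_iff_clinear:
  "teq xs ys \<longleftrightarrow> (\<forall>f g. clinear f \<longrightarrow> clinear g \<longrightarrow>
      (\<Sum>(v, w)\<leftarrow>xs. f v * (g w :: complex)) = (\<Sum>(v, w)\<leftarrow>ys. f v * g w))"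
  by (simp add: teq_def clinear_fun_iff_clinear)

lemma teq_sym: "teq xs ys \<Longrightarrow> teq ys xs"
  and teq_trans [trans]: "teq xs ys \<Longrightarrow> teq ys zs \<Longrightarrow> teq xs zs"
  by (simp_all add: teq_def)

lemma sum_list_concat_map:
  "(\<Sum>x\<leftarrow>concat (map g xs). f x) = (\<Sum>x\<leftarrow>xs. \<Sum>y\<leftarrow>g x. (f y :: 'b::comm_monoid_add))"
  by (induction xs) simp_all

lemma sum_list_upt: "(\<Sum>i\<leftarrow>[0..<n]. f i) = (\<Sum>i<n. (f i :: 'b::comm_monoid_add))"
  by (simp add: interv_sum_list_conv_sum_set_nat atLeast0LessThan)

lemma sum_list_sum_swap:
  "(\<Sum>x\<leftarrow>xs. \<Sum>e\<in>E. f x e) = (\<Sum>e\<in>E. \<Sum>x\<leftarrow>xs. (f x e :: 'b::comm_monoid_add))"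
  by (induction xs) (simp_all add: sum.distrib)

lemma teq_slice:
  assumes "teq xs ys" "clinear f"
  shows "(\<Sum>(v, w)\<leftarrow>xs. f v *\<^sub>C w) = (\<Sum>(v, w)\<leftarrow>ys. f v *\<^sub>C w)"
proof (rule clinear_functionals_separate)
  fix g :: "'b \<Rightarrow> complex" assume g: "clinear g"
  show "g (\<Sum>(v, w)\<leftarrow>xs. f v *\<^sub>C w) = g (\<Sum>(v, w)\<leftarrow>ys. f v *\<^sub>C w)"
    using assms g
    by (simp add: teq_iff_clinear clinear_sum_list case_prod_unfold cvs.linear_scale scaleC_complex)
qed

lemma sum_list_coordinates:
  assumes "\<And>x. x \<in> set xs \<Longrightarrow> (\<Sum>e\<in>E. f e (g x) *\<^sub>C e) = g x"
    and "\<And>x. clinear (B x)"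
  shows "(\<Sum>x\<leftarrow>xs. B x (g x)) = (\<Sum>e\<in>E. \<Sum>x\<leftarrow>xs. f e (g x) *\<^sub>C B x e)"
proof -
  have "B x (g x) = (\<Sum>e\<in>E. f e (g x) *\<^sub>C B x e)" if "x \<in> set xs" for x
    by (subst (1) assms(1)[OF that, symmetric])
      (simp add: cvs.linear_sum[OF assms(2)] cvs.linear_scale[OF assms(2)])
  then show ?thesis by (simp add: sum_list_sum_swap[symmetric] cong: map_cong)
qed

lemma cbilinear_sum_list_coordinates:
  assumes "\<And>v. v \<in> fst ` set xs \<Longrightarrow> (\<Sum>e\<in>E. f e v *\<^sub>C e) = v" "cbilinear B"
  shows "(\<Sum>(v, w)\<leftarrow>xs. B v w) = (\<Sum>e\<in>E. B e (\<Sum>(v, w)\<leftarrow>xs. f e v *\<^sub>C w))"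
  using sum_list_coordinates[where f = f and g = fst and B = "\<lambda>x v. B v (snd x)"] assms
  by (simp add: case_prod_unfold clinear_sum_list cvs.linear_scale cbilinear_def)

lemma teq_cbilinear:
  assumes "teq xs ys" "cbilinear B"
  shows "(\<Sum>(v, w)\<leftarrow>xs. B v w) = (\<Sum>(v, w)\<leftarrow>ys. B v w)"
proof -
  have "finite (fst ` set (xs @ ys))" by simp
  then obtain E f where f: "\<And>e. clinear (f e :: 'a \<Rightarrow> complex)"
    "\<And>v. v \<in> fst ` set (xs @ ys) \<Longrightarrow> (\<Sum>e\<in>E. f e v *\<^sub>C e) = v"
    by (rule finite_coordinates) blast
  have "(\<Sum>(v, w)\<leftarrow>zs. B v w) = (\<Sum>e\<in>E. B e (\<Sum>(v, w)\<leftarrow>zs. f e v *\<^sub>C w))"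
    if "set zs \<subseteq> set (xs @ ys)" for zs
    using f(2) that by (intro cbilinear_sum_list_coordinates assms(2)) blast
  from this[of xs] this[of ys] show ?thesis
    by (simp add: teq_slice[OF assms(1) f(1)])
qed

lemma teqI:
  assumes "\<And>B :: 'v::cvec \<Rightarrow> 'w::cvec \<Rightarrow> complex. cbilinear B \<Longrightarrow>
    (\<Sum>(v, w)\<leftarrow>xs. B v w) = (\<Sum>(v, w)\<leftarrow>ys. B v w)"
  shows "teq xs ys"
  unfolding teq_iff_clinear by (auto simp flip: scaleC_complex_def intro!: assms cbilinear_scaleC)

lemma teq_expansion:
  fixes xs :: "('v::cvec \<times> 'w::cvec) list"
  obtains es f where "\<And>e. clinear (f e :: 'v \<Rightarrow> complex)"
    "teq xs (map (\<lambda>e. (e, \<Sum>(v, w)\<leftarrow>xs. f e v *\<^sub>C w)) es)"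
proof -
  have "finite (fst ` set xs)" by simp
  then obtain E f where E: "finite E" and f: "\<And>e. clinear (f e :: 'v \<Rightarrow> complex)"
    "\<And>v. v \<in> fst ` set xs \<Longrightarrow> (\<Sum>e\<in>E. f e v *\<^sub>C e) = v"
    by (rule finite_coordinates) blast
  obtain es where "set es = E" "distinct es" using E finite_distinct_list by blast
  then have "teq xs (map (\<lambda>e. (e, \<Sum>(v, w)\<leftarrow>xs. f e v *\<^sub>C w)) es)"
    by (intro teqI)
      (simp add: cbilinear_sum_list_coordinates[OF f(2)] o_def sum_list_distinct_conv_sum_set)
  with f(1) show ?thesis by (rule that)
qed

definition ctrilinear :: "('t::cvec \<Rightarrow> 'u::cvec \<Rightarrow> 'v::cvec \<Rightarrow> 'w::cvec) \<Rightarrow> bool" where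
  "ctrilinear B \<longleftrightarrow> (\<forall>u. cbilinear (B u)) \<and> (\<forall>v w. clinear (\<lambda>u. B u v w))"

lemma ctrilinearI: "(\<And>u. cbilinear (B u)) \<Longrightarrow> (\<And>v w. clinear (\<lambda>u. B u v w)) \<Longrightarrow> ctrilinear B"
  by (simp add: ctrilinear_def)

lemma teq3_iff_clinear:
  "teq3 xs ys \<longleftrightarrow> (\<forall>f g h. clinear f \<longrightarrow> clinear g \<longrightarrow> clinear h \<longrightarrow>
      (\<Sum>(u, v, w)\<leftarrow>xs. f u * g v * (h w :: complex)) = (\<Sum>(u, v, w)\<leftarrow>ys. f u * g v * h w))"
  by (simp add: teq3_def clinear_fun_iff_clinear)

lemma teq3_ctrilinear:
  assumes "teq3 xs ys" "ctrilinear B"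
  shows "(\<Sum>(u, v, w)\<leftarrow>xs. B u v w) = (\<Sum>(u, v, w)\<leftarrow>ys. B u v w)"
proof -
  have B: "cbilinear (B u)" "clinear (\<lambda>u. B u v w)" for u v w
    using assms(2) by (simp_all add: ctrilinear_def)
  have slice: "teq (map (\<lambda>(u, v, w). (f u *\<^sub>C v, w)) xs) (map (\<lambda>(u, v, w). (f u *\<^sub>C v, w)) ys)"
    if "clinear f" for f :: "'a \<Rightarrow> complex"
    using assms(1) that
    by (simp add: teq_iff_clinear teq3_iff_clinear o_def case_prod_unfold cvs.linear_scale
        scaleC_complex)
  have "finite (fst ` set (xs @ ys))" by simp
  then obtain E f where f: "\<And>e. clinear (f e :: 'a \<Rightarrow> complex)"
    "\<And>v. v \<in> fst ` set (xs @ ys) \<Longrightarrow> (\<Sum>e\<in>E. f e v *\<^sub>C e) = v"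
    by (rule finite_coordinates) blast
  have "(\<Sum>(u, v, w)\<leftarrow>zs. B u v w) =
      (\<Sum>e\<in>E. \<Sum>(v, w)\<leftarrow>map (\<lambda>(u, v, w). (f e u *\<^sub>C v, w)) zs. B e v w)"
    if "set zs \<subseteq> set (xs @ ys)" for zs
  proof -
    have "(\<Sum>x\<leftarrow>zs. B (fst x) (fst (snd x)) (snd (snd x))) =
        (\<Sum>e\<in>E. \<Sum>x\<leftarrow>zs. f e (fst x) *\<^sub>C B e (fst (snd x)) (snd (snd x)))"
      using f(2) that B(2)
      by (intro sum_list_coordinates[where B = "\<lambda>x u. B u (fst (snd x)) (snd (snd x))"]) blast+
    then show ?thesis
      by (simp add: case_prod_unfold o_def cvs.linear_scale[OF cbilinear_left[OF B(1)]])
  qed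
  from this[of xs] this[of ys] show ?thesis
    by (simp only: teq_cbilinear[OF slice[OF f(1)] B(1)] set_append Un_upper1 Un_upper2)
qed

section \<open>Positive elements for a C*-seminorm\<close>

lemma star_0 [simp]: "star (0 :: 'z::star_alg) = 0"
  using star_scaleC[of 0 0] by simp

lemma star_1 [simp]: "star (1 :: 'z::star_alg) = 1"
  by (metis mult_1_left mult_1_right star_mult star_star)

lemma star_minus: "star (- x) = - star (x :: 'z::star_alg)"
  by (metis add_eq_0_iff star_0 star_add)

lemma star_diff: "star (x - y) = star x - star (y :: 'z::star_alg)"
  by (metis diff_conv_add_uminus star_add star_minus)

lemma star_sum: "star (sum f A) = (\<Sum>i\<in>A. star (f i :: 'z::star_alg))"
  by (induction A rule: infinite_finite_induct) (simp_all add: star_add)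

lemma star_power: "star (x ^ n) = star (x :: 'z::star_alg) ^ n"
  by (induction n) (simp_all add: star_mult power_commutes)

lemmas star_simps = star_star star_add star_minus star_diff star_mult star_scaleC

lemma scaleC_two: "2 *\<^sub>C x = x + (x :: 'z::cvec)"
  using scaleC_add_left[of 1 1 x] by simp

definition scal :: "real \<Rightarrow> 'z::calg" where
  "scal t = complex_of_real t *\<^sub>C 1"

lemma scal_0 [simp]: "scal 0 = 0"
  and scal_1 [simp]: "scal 1 = 1"
  and scal_add: "scal (s + t) = scal s + scal t"
  and scal_diff: "scal (s - t) = scal s - scal t"
  and scaleC_scal: "complex_of_real s *\<^sub>C scal t = scal (s * t)"
  and scal_mult: "scal s * scal t = scal (s * t)"
  by (simp_all add: scal_def scaleC_add_left cvs.scale_left_diff_distrib mult_scaleC_left)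

lemma scal_commute: "scal t * x = x * scal t"
  by (simp add: scal_def mult_scaleC_left mult_scaleC_right)

lemma star_scal [simp]: "star (scal t) = (scal t :: 'z::star_alg)"
  by (simp add: scal_def star_scaleC)

lemma le_star_of_square_le:
  fixes p :: "'z::star_alg \<Rightarrow> real"
  assumes "(p x)\<^sup>2 \<le> p (star x * x)" "p (star x * x) \<le> p (star x) * p x"
    and "p x \<ge> 0" "p (star x) \<ge> 0"
  shows "p x \<le> p (star x)"
proof (cases "p x = 0")
  case False
  have "p x * p x \<le> p (star x) * p x" using assms(1,2) by (simp add: power2_eq_square)
  with False assms(3) show ?thesis by simp
qed (use assms(4) in simp)

lemma cstar_seminormI:
  fixes p :: "'z::star_alg \<Rightarrow> real"
  assumes add: "\<And>x y. p (x + y) \<le> p x + p y"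
    and scale: "\<And>c x. p (c *\<^sub>C x) \<le> cmod c * p x"
    and mult: "\<And>x y. p (x * y) \<le> p x * p y"
    and star_self: "\<And>x. (p x)\<^sup>2 \<le> p (star x * x)"
  shows "cstar_seminorm p"
proof -
  have "p 0 \<ge> 0" using star_self[of 0] by (simp add: order_trans[OF zero_le_power2])
  then have "p 0 = 0" using scale[of 0 0] by simp
  then have nonneg: "p x \<ge> 0" for x
    using add[of x "- x"] scale[of "-1" x] by simp
  have "p (c *\<^sub>C x) = cmod c * p x" for c x
  proof (cases "c = 0")
    case False
    then have "p x \<le> p (c *\<^sub>C x) / cmod c"
      using scale[of "inverse c" "c *\<^sub>C x"] by (simp add: norm_inverse divide_inverse mult.commute)
    with False scale[of c x] show ?thesis by (simp add: field_simps)
  qed (simp add: \<open>p 0 = 0\<close>)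
  moreover have "p (star x * x) = (p x)\<^sup>2" for x
  proof (rule antisym[OF _ star_self])
    have "p (star x) * p x \<le> p x * p x"
      using le_star_of_square_le[of p "star x", OF star_self mult nonneg nonneg]
      by (intro mult_right_mono nonneg) (simp add: star_star)
    with mult[of "star x" x] show "p (star x * x) \<le> (p x)\<^sup>2" by (simp add: power2_eq_square)
  qed
  ultimately show ?thesis using add mult by (simp add: cstar_seminorm_def)
qed

text \<open>The iteration \<open>x \<mapsto> (w + x\<^sup>2) / 2\<close> converges to \<open>1 - sqrt (1 - w)\<close>.  All iterates are
  polynomials in \<open>w\<close> with nonnegative coefficients, so their norms are controlled by the values at
  \<open>w = 1\<close>.\<close>

primrec sqrt_iter :: "'z::calg \<Rightarrow> nat \<Rightarrow> 'z" where
  "sqrt_iter w 0 = 0"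
| "sqrt_iter w (Suc k) = (1/2) *\<^sub>C (w + sqrt_iter w k * sqrt_iter w k)"

primrec sqrt_iter_bound :: "nat \<Rightarrow> real" where
  "sqrt_iter_bound 0 = 0"
| "sqrt_iter_bound (Suc k) = (1 + (sqrt_iter_bound k)\<^sup>2) / 2"

lemma sqrt_iter_Suc_diff:
  "sqrt_iter w (Suc k) - sqrt_iter w k =
    (1/2) *\<^sub>C ((1 - sqrt_iter w k) * (1 - sqrt_iter w k) - (1 - w))"
  (is "_ = (1/2) *\<^sub>C ?d")
proof -
  let ?x = "sqrt_iter w k"
  have "(1/2) *\<^sub>C (w + ?x * ?x) - ?x = (1/2) *\<^sub>C (w + ?x * ?x - 2 *\<^sub>C ?x)"
    by (simp add: cvs.scale_right_diff_distrib)
  also have "w + ?x * ?x - 2 *\<^sub>C ?x = ?d"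
    by (simp add: scaleC_two algebra_simps)
  finally show ?thesis by simp
qed

lemma commute_sqrt_iter: "c * w = w * c \<Longrightarrow> c * sqrt_iter w k = sqrt_iter w k * c"
proof (induction k)
  case (Suc k)
  then have "c * (sqrt_iter w k * sqrt_iter w k) = sqrt_iter w k * sqrt_iter w k * c"
    by (metis mult.assoc)
  with Suc.prems show ?case
    by (simp add: mult_scaleC_left mult_scaleC_right distrib_left distrib_right)
qed simp

lemma sqrt_iter_Suc_diff_Suc:
  "sqrt_iter w (Suc (Suc k)) - sqrt_iter w (Suc k) =
    (1/2) *\<^sub>C ((sqrt_iter w (Suc k) - sqrt_iter w k) * (sqrt_iter w (Suc k) + sqrt_iter w k))"
proof -
  let ?x = "sqrt_iter w k" and ?y = "sqrt_iter w (Suc k)"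
  have "?x * ?y = ?y * ?x"
    by (intro commute_sqrt_iter commute_sqrt_iter[symmetric] refl)
  have "sqrt_iter w (Suc (Suc k)) - ?y = (1/2) *\<^sub>C (w + ?y * ?y) - (1/2) *\<^sub>C (w + ?x * ?x)"
    by (intro arg_cong2[of _ _ _ _ minus] sqrt_iter.simps(2))
  also have "\<dots> = (1/2) *\<^sub>C (?y * ?y - ?x * ?x)"
    by (simp only: cvs.scale_right_diff_distrib[symmetric] add_diff_cancel_left)
  also have "?y * ?y - ?x * ?x = (?y - ?x) * (?y + ?x)"
    using \<open>?x * ?y = ?y * ?x\<close> by (simp add: algebra_simps del: sqrt_iter.simps)
  finally show ?thesis .
qed

lemma star_sqrt_iter: "star w = w \<Longrightarrow> star (sqrt_iter w k) = sqrt_iter w k"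
  by (induction k) (simp_all add: star_simps)

lemma sqrt_iter_bound_nonneg: "0 \<le> sqrt_iter_bound k"
  by (induction k) simp_all

lemma sqrt_iter_bound_le_1: "sqrt_iter_bound k \<le> 1"
proof (induction k)
  case (Suc k)
  then show ?case using power_le_one[OF sqrt_iter_bound_nonneg[of k]] by simp
qed simp

lemma sqrt_iter_bound_diff_tendsto_0:
  "(\<lambda>k. sqrt_iter_bound (Suc k) - sqrt_iter_bound k) \<longlonglongrightarrow> 0"
proof -
  have "sqrt_iter_bound (Suc k) - sqrt_iter_bound k = (1 - sqrt_iter_bound k)\<^sup>2 / 2" for k
    by (simp add: power2_eq_square field_simps)
  then have "incseq sqrt_iter_bound"
    by (intro incseq_SucI)
      (metis diff_ge_0_iff_ge zero_le_power2 divide_nonneg_pos zero_less_numeral)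
  then obtain L where "sqrt_iter_bound \<longlonglongrightarrow> L"
    using incseq_convergent sqrt_iter_bound_le_1 by metis
  from tendsto_diff[OF LIMSEQ_Suc[OF this] this] show ?thesis by simp
qed

lemma le_of_power_of_2_le:
  fixes L R C :: real
  assumes "R > 0" and le: "\<And>k. L ^ 2 ^ k * R \<le> R ^ 2 ^ k * (R + 2 ^ k * C)"
  shows "L \<le> R"
proof (rule ccontr)
  assume "\<not> L \<le> R"
  define d where "d = L / R - 1"
  have "d > 0" using \<open>\<not> L \<le> R\<close> \<open>R > 0\<close> by (simp add: d_def field_simps)
  have L: "L = (1 + d) * R" using \<open>R > 0\<close> by (simp add: d_def)
  have bound: "m * d\<^sup>2 \<le> 2 * C / R" if "m = 2 ^ k" for m :: real and k
  proof -
    have "R ^ 2 ^ Suc k * ((1 + d) ^ 2 ^ Suc k * R) \<le> R ^ 2 ^ Suc k * (R + 2 * m * C)"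
      using le[of "Suc k"] unfolding L power_mult_distrib that by (simp only: mult_ac power_Suc)
    then have "(1 + d) ^ 2 ^ Suc k * R \<le> R + 2 * m * C"
      using \<open>R > 0\<close> by (simp only: mult_le_cancel_left_pos zero_less_power)
    then have "(1 + d) ^ 2 ^ Suc k \<le> 1 + m * (2 * C / R)"
      using \<open>R > 0\<close> by (simp add: field_simps)
    moreover have "1 + m * d \<le> (1 + d) ^ 2 ^ k"
      using Bernoulli_inequality[of d "2 ^ k"] \<open>d > 0\<close> that by simp
    then have "(1 + m * d)\<^sup>2 \<le> ((1 + d) ^ 2 ^ k)\<^sup>2"
      using \<open>d > 0\<close> that by (intro power_mono) auto
    ultimately have "(1 + m * d)\<^sup>2 \<le> 1 + m * (2 * C / R)"
      by (simp add: power_mult[symmetric] mult.commute)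
    moreover have "(1 + m * d)\<^sup>2 = 1 + 2 * (m * d) + m * (m * d\<^sup>2)"
      by (simp add: power2_eq_square algebra_simps)
    moreover have "m * d \<ge> 0" using \<open>d > 0\<close> that by simp
    ultimately have "m * (m * d\<^sup>2) \<le> m * (2 * C / R)" by linarith
    moreover have "m > 0" using that by simp
    ultimately show ?thesis by (simp only: mult_le_cancel_left_pos)
  qed
  obtain n :: nat where n: "2 * C / R / d\<^sup>2 < n" using reals_Archimedean2 by blast
  with \<open>d > 0\<close> have "2 * C / R < n * d\<^sup>2"
    by (simp only: pos_divide_less_eq zero_less_power)
  also have "\<dots> \<le> 2 ^ n * d\<^sup>2"
    using of_nat_less_two_power[of n, where 'a = real] by (intro mult_right_mono) simp_all
  finally have "2 * C / R < 2 ^ n * d\<^sup>2" .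
  with bound[OF refl, of n] show False by simp
qed

locale cstar_seminormed =
  fixes p :: "'z::star_alg \<Rightarrow> real"
  assumes cstar_seminorm: "cstar_seminorm p"
begin

lemma add_le: "p (x + y) \<le> p x + p y"
  and scale: "p (c *\<^sub>C x) = cmod c * p x"
  and mult_le: "p (x * y) \<le> p x * p y"
  and star_self: "p (star x * x) = (p x)\<^sup>2"
  using cstar_seminorm by (simp_all add: cstar_seminorm_def)

lemma zero [simp]: "p 0 = 0"
  using scale[of 0 0] by simp

lemma minus [simp]: "p (- x) = p x"
  using scale[of "-1" x] by simp

lemma nonneg [simp]: "p x \<ge> 0"
  using add_le[of x "- x"] by simp

lemma diff_le: "p (x - y) \<le> p x + p y"
  using add_le[of x "- y"] by simp

lemma diff_commute: "p (x - y) = p (y - x)"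
  using minus[of "x - y"] by simp

lemma le_diff_add: "p x \<le> p (x - y) + p y"
  using add_le[of "x - y" y] by simp

lemma star_eq [simp]: "p (star x) = p x"
proof -
  have "p x \<le> p (star x)" for x
    by (rule le_star_of_square_le) (simp_all add: mult_le flip: star_self)
  from this[of x] this[of "star x"] show ?thesis by (simp add: star_star)
qed

lemma square_herm: "star a = a \<Longrightarrow> p (a * a) = (p a)\<^sup>2"
  using star_self[of a] by simp

lemma cube_le_herm:
  assumes "star b = b"
  shows "p b ^ 3 \<le> p (b * b * b)"
proof (cases "p b = 0")
  case False
  have "p b ^ 3 * p b = p (b * b * (b * b))"
    using assms by (simp add: square_herm star_mult power2_eq_square power3_eq_cube)
  also have "\<dots> \<le> p (b * b * b) * p b"
    using mult_le[of "b * b * b" b] by (simp add: mult.assoc)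
  finally show ?thesis using False by (simp add: less_le)
qed simp

lemma scal_le: "p (scal t) \<le> \<bar>t\<bar>"
proof -
  have "p 1 = (p 1)\<^sup>2" using star_self[of 1] by simp
  then have "p 1 \<le> 1" by (auto simp: power2_eq_square)
  then show ?thesis by (simp add: scal_def scale mult_left_le)
qed

lemma power_of_2_herm:
  assumes "star g = g"
  shows "p (g ^ 2 ^ k) = p g ^ 2 ^ k"
proof (induction k)
  case (Suc k)
  have "g ^ 2 ^ Suc k = star (g ^ 2 ^ k) * g ^ 2 ^ k"
    by (simp add: star_power assms mult_2 power_add)
  then show ?case using Suc by (simp add: star_self power_mult[symmetric] mult.commute)
qed simp

lemma sqrt_iter_diff_le:
  assumes "p w \<le> 1"
  shows "p (sqrt_iter w k) \<le> sqrt_iter_bound k"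
    and "p (sqrt_iter w (Suc k) - sqrt_iter w k) \<le> sqrt_iter_bound (Suc k) - sqrt_iter_bound k"
proof -
  let ?x = "sqrt_iter w" and ?t = sqrt_iter_bound
  have le: "p (?x k) \<le> ?t k" for k
  proof (induction k)
    case (Suc k)
    have "p (?x k * ?x k) \<le> (?t k)\<^sup>2"
      unfolding power2_eq_square using Suc
      by (intro order_trans[OF mult_le] mult_mono order_trans[OF nonneg]) auto
    with add_le[of w "?x k * ?x k"] assms show ?case by (simp add: scale)
  qed simp
  show "p (?x k) \<le> ?t k" by (rule le)
  show "p (?x (Suc k) - ?x k) \<le> ?t (Suc k) - ?t k"
  proof (induction k)
    case 0
    with assms show ?case by (simp add: scale)
  next
    case (Suc k)
    have "p (?x (Suc (Suc k)) - ?x (Suc k)) \<le> (p (?x (Suc k) - ?x k) * p (?x (Suc k) + ?x k)) / 2"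
      unfolding sqrt_iter_Suc_diff_Suc by (simp add: scale mult_le del: sqrt_iter.simps)
    also have "\<dots> \<le> ((?t (Suc k) - ?t k) * (?t (Suc k) + ?t k)) / 2"
      by (intro divide_right_mono mult_mono Suc.IH order_trans[OF add_le add_mono[OF le le]]
          order_trans[OF nonneg Suc.IH] nonneg) simp
    also have "\<dots> = ?t (Suc (Suc k)) - ?t (Suc k)"
      by (simp add: power2_eq_square field_simps)
    finally show ?case .
  qed
qed

text \<open>For hermitian \<open>g\<close> the condition says that the spectrum of \<open>g\<close> in the completion lies in
  \<open>[0, 2 T]\<close>.\<close>

definition pos :: "'z \<Rightarrow> bool" where
  "pos g \<longleftrightarrow> star g = g \<and> (\<exists>T. p (scal T - g) \<le> T)"

lemma scal_diff_mono: "p (scal T - g) \<le> T \<Longrightarrow> T \<le> T' \<Longrightarrow> p (scal T' - g) \<le> T'"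
  using add_le[of "scal T - g" "scal (T' - T)"] scal_le[of "T' - T"] by (simp add: scal_diff)

lemma posI: "star g = g \<Longrightarrow> p (scal T - g) \<le> T \<Longrightarrow> pos g"
  unfolding pos_def by blast

lemma pos_herm: "pos g \<Longrightarrow> star g = g"
  by (simp add: pos_def)

lemma posE:
  assumes "pos g"
  obtains T where "T > 0" "p (scal T - g) \<le> T"
proof -
  obtain S where "p (scal S - g) \<le> S" using assms by (auto simp: pos_def)
  then have "p (scal (max S 1) - g) \<le> max S 1" by (rule scal_diff_mono) simp
  then show ?thesis by (rule that[rotated]) simp
qed

lemma pos_scal_diff_herm: "star g = g \<Longrightarrow> p g \<le> c \<Longrightarrow> pos (scal c - g)"
  by (rule posI[of _ c]) (simp_all add: star_diff)

lemma pos_add: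
  assumes "pos g" "pos h"
  shows "pos (g + h)"
proof -
  obtain S T where "p (scal S - g) \<le> S" "p (scal T - h) \<le> T"
    using assms by (auto simp: pos_def)
  then have "p (scal (S + T) - (g + h)) \<le> S + T"
    using add_le[of "scal S - g" "scal T - h"] by (simp add: scal_add algebra_simps)
  with assms show ?thesis by (intro posI) (simp_all add: star_add pos_herm)
qed

lemma pos_scale:
  assumes "pos g" "c \<ge> 0"
  shows "pos (complex_of_real c *\<^sub>C g)"
proof -
  obtain T where "p (scal T - g) \<le> T" using assms by (auto simp: pos_def)
  then have "c * p (scal T - g) \<le> c * T" using assms(2) by (rule mult_left_mono)
  moreover have "scal (c * T) - complex_of_real c *\<^sub>C g = complex_of_real c *\<^sub>C (scal T - g)"
    by (simp add: scaleC_scal cvs.scale_right_diff_distrib)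
  ultimately have "p (scal (c * T) - complex_of_real c *\<^sub>C g) \<le> c * T"
    using assms(2) by (simp add: scale)
  with assms(1) show ?thesis by (intro posI) (simp_all add: star_scaleC pos_herm)
qed

lemma pos_scal: "c \<ge> 0 \<Longrightarrow> pos (scal c)"
  by (rule posI[of _ c]) simp_all

lemma pos_sum: "(\<And>i. i \<in> A \<Longrightarrow> pos (f i)) \<Longrightarrow> pos (sum f A)"
  using pos_scal[of 0] by (induction A rule: infinite_finite_induct) (simp_all add: pos_add)

lemma one_minus_approx_sqrt:
  assumes w: "star w = w" "p w \<le> 1" and "e > 0"
  obtains x where "star x = x" "p x \<le> 1" "\<And>c. c * w = w * c \<Longrightarrow> c * x = x * c"
    "p ((1 - x) * (1 - x) - (1 - w)) \<le> e"
proof -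
  have "\<forall>\<^sub>F k in sequentially. sqrt_iter_bound (Suc k) - sqrt_iter_bound k < e / 2"
    using sqrt_iter_bound_diff_tendsto_0 by (rule order_tendstoD) (use \<open>e > 0\<close> in simp)
  then obtain k where k: "sqrt_iter_bound (Suc k) - sqrt_iter_bound k < e / 2"
    by (auto simp: eventually_sequentially)
  show ?thesis
  proof (rule that[of "sqrt_iter w k"])
    show "star (sqrt_iter w k) = sqrt_iter w k" by (rule star_sqrt_iter[OF w(1)])
    show "p (sqrt_iter w k) \<le> 1"
      using sqrt_iter_diff_le(1)[OF w(2), of k] sqrt_iter_bound_le_1[of k] by simp
    have "p (sqrt_iter w (Suc k) - sqrt_iter w k) \<le> e / 2"
      using sqrt_iter_diff_le(2)[OF w(2), of k] k by linarith
    then show "p ((1 - sqrt_iter w k) * (1 - sqrt_iter w k) - (1 - w)) \<le> e"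
      unfolding sqrt_iter_Suc_diff by (simp add: scale)
  qed (rule commute_sqrt_iter)
qed

lemma pos_approx_sqrt:
  assumes g: "pos g" and "e > 0"
  obtains a where "pos a" "\<And>c. c * g = g * c \<Longrightarrow> c * a = a * c" "p (g - a * a) \<le> e"
proof -
  obtain T where T: "T > 0" "p (scal T - g) \<le> T" using g by (rule posE)
  define w where "w = complex_of_real (1/T) *\<^sub>C (scal T - g)"
  have "complex_of_real (1/T) *\<^sub>C scal T = (1 :: 'z)"
    unfolding scaleC_scal using T by simp
  then have w_diff: "1 - w = complex_of_real (1/T) *\<^sub>C g"
    unfolding w_def cvs.scale_right_diff_distrib by simp
  have "star w = w" "p w \<le> 1"
    using T pos_herm[OF g] by (simp_all add: w_def star_simps scale norm_divide)
  moreover have "e / T > 0" using T \<open>e > 0\<close> by simp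
  ultimately obtain x where x: "star x = x" "p x \<le> 1" "\<And>c. c * w = w * c \<Longrightarrow> c * x = x * c"
    "p ((1 - x) * (1 - x) - (1 - w)) \<le> e / T"
    by (rule one_minus_approx_sqrt) blast
  define a where "a = complex_of_real (sqrt T) *\<^sub>C (1 - x)"
  show ?thesis
  proof (rule that[of a])
    have "scal (sqrt T) - a = complex_of_real (sqrt T) *\<^sub>C x"
      by (simp add: a_def scal_def cvs.scale_right_diff_distrib)
    then have "p (scal (sqrt T) - a) \<le> sqrt T"
      using T x(2) by (simp add: scale mult_left_le)
    then show "pos a" using x(1) by (intro posI) (simp_all add: a_def star_simps)
  next
    fix c assume "c * g = g * c"
    then have "c * w = w * c"
      by (simp add: w_def mult_scaleC_left mult_scaleC_right algebra_simps scal_commute[of T c])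
    from x(3)[OF this] show "c * a = a * c"
      by (simp add: a_def mult_scaleC_left mult_scaleC_right algebra_simps)
  next
    have "a * a = complex_of_real T *\<^sub>C ((1 - x) * (1 - x))"
      using T by (simp add: a_def mult_scaleC_left mult_scaleC_right flip: of_real_mult)
    moreover have "g = complex_of_real T *\<^sub>C (1 - w)"
      using T by (simp add: w_diff)
    ultimately have "a * a - g = complex_of_real T *\<^sub>C ((1 - x) * (1 - x) - (1 - w))"
      by (simp only: cvs.scale_right_diff_distrib)
    then have "p (a * a - g) \<le> T * (e / T)"
      using T x(4) by (simp only: scale) (simp add: field_simps)
    then show "p (g - a * a) \<le> e" using T by (simp add: diff_commute[of g])
  qed
qed

lemma herm_square_le_sum_squares:
  assumes "star a = a" "star b = b" "a * b = b * a"
  shows "(p a)\<^sup>2 \<le> p (a * a + b * b)"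
proof -
  define u where "u = a + \<i> *\<^sub>C b"
  have "star u * u = a * a + b * b"
    by (simp add: u_def star_simps algebra_simps mult_scaleC_left mult_scaleC_right assms)
  then have u: "(p u)\<^sup>2 = p (a * a + b * b)" using star_self[of u] by simp
  have "u + star u = 2 *\<^sub>C a" by (simp add: u_def star_simps assms scaleC_two)
  then have "p a \<le> p u" using add_le[of u "star u"] by (simp add: scale)
  then show ?thesis unfolding u[symmetric] by (rule power_mono) simp
qed

lemma scal_diff_square_le:
  assumes a: "star a = a" "(p a)\<^sup>2 \<le> T"
  shows "p (scal T - a * a) \<le> T"
proof (rule field_le_epsilon)
  fix e :: real assume "e > 0"
  define g where "g = scal T - a * a"
  have "T \<ge> 0" using a(2) zero_le_power2 order_trans by blast
  have "pos g"
    unfolding g_def using a by (intro pos_scal_diff_herm) (simp_all add: star_mult square_herm)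
  then obtain b where b: "pos b" "\<And>c. c * g = g * c \<Longrightarrow> c * b = b * c" "p (g - b * b) \<le> e / 2"
    using half_gt_zero[OF \<open>e > 0\<close>] by (rule pos_approx_sqrt) blast
  have "a * b = b * a"
    by (rule b(2)) (simp add: g_def algebra_simps scal_commute[of T a])
  then have "(p b)\<^sup>2 \<le> p (b * b + a * a)"
    using a b(1) by (intro herm_square_le_sum_squares) (auto simp: pos_herm)
  also have "b * b + a * a = scal T - (g - b * b)" by (simp add: g_def)
  also have "p \<dots> \<le> T + e / 2"
    using diff_le[of "scal T" "g - b * b"] scal_le[of T] b(3) \<open>T \<ge> 0\<close> by simp
  finally have "p (b * b) \<le> T + e / 2" using b(1) by (simp add: square_herm pos_herm)
  then show "p (scal T - a * a) \<le> T + e"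
    using le_diff_add[of g "b * b"] b(3) by (simp add: g_def)
qed

lemma pos_square: "star a = a \<Longrightarrow> pos (a * a)"
  using scal_diff_square_le[of a "(p a)\<^sup>2"] by (intro posI) (simp_all add: star_mult)

lemma pos_scal_diff_le:
  assumes "pos g" "p g \<le> T"
  shows "p (scal T - g) \<le> T"
proof (rule field_le_epsilon)
  fix e :: real assume "e > 0"
  then have "e / 3 > 0" by simp
  with assms(1) obtain a where a: "pos a" "p (g - a * a) \<le> e / 3"
    by (rule pos_approx_sqrt)
  have "(p a)\<^sup>2 \<le> T + e / 3"
    using le_diff_add[of "a * a" g] a assms(2)
    by (simp add: diff_commute[of _ g] square_herm pos_herm)
  then have "p (scal (T + e / 3) - a * a) \<le> T + e / 3"
    using a(1) by (intro scal_diff_square_le pos_herm)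
  moreover have "p (scal T - g) \<le> p ((scal (T + e / 3) - a * a) - (g - a * a)) + p (scal (e / 3))"
    using diff_le[of "(scal (T + e / 3) - a * a) - (g - a * a)" "scal (e / 3)"]
    by (simp add: scal_add)
  ultimately show "p (scal T - g) \<le> T + e"
    using diff_le[of "scal (T + e / 3) - a * a" "g - a * a"] scal_le[of "e / 3"] a(2) \<open>e > 0\<close>
    by linarith
qed

lemma pos_closed:
  assumes "star g = g" and approx: "\<And>e. e > 0 \<Longrightarrow> \<exists>h. pos h \<and> p (g - h) \<le> e"
  shows "pos g"
proof -
  have "p (scal (p g + 1) - g) \<le> p g + 1"
  proof (rule field_le_epsilon)
    fix e :: real assume "e > 0"
    then obtain h where h: "pos h" "p (g - h) \<le> min e 1"
      using approx[of "min e 1"] by auto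
    have "p h \<le> p g + 1" using le_diff_add[of h g] h(2) by (simp add: diff_commute[of h])
    from pos_scal_diff_le[OF h(1) this] show "p (scal (p g + 1) - g) \<le> p g + 1 + e"
      using diff_le[of "scal (p g + 1) - h" "g - h"] h(2) by simp
  qed
  with assms(1) show ?thesis by (rule posI)
qed

lemma commuting_pos_approx_sqrt:
  assumes "pos g" "pos h" "g * h = h * g" "e > 0"
  obtains a b where "pos a" "pos b" "a * b = b * a" "p (g - a * a) \<le> e" "p (h - b * b) \<le> e"
proof -
  obtain a where a: "pos a" "\<And>c. c * g = g * c \<Longrightarrow> c * a = a * c" "p (g - a * a) \<le> e"
    using assms(1,4) by (rule pos_approx_sqrt) blast
  obtain b where b: "pos b" "\<And>c. c * h = h * c \<Longrightarrow> c * b = b * c" "p (h - b * b) \<le> e"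
    using assms(2,4) by (rule pos_approx_sqrt) blast
  have "a * b = b * a" using a(2) b(2) assms(3) by metis
  with a b show ?thesis by (intro that)
qed

lemma pos_mult_commuting:
  assumes "pos g" "pos h" "g * h = h * g"
  shows "pos (g * h)"
proof (rule pos_closed)
  show "star (g * h) = g * h" using assms by (simp add: star_mult pos_herm)
  fix e :: real assume "e > 0"
  define K where "K = p g + p h + 1"
  have "K > 0" unfolding K_def by (intro add_nonneg_pos add_nonneg_nonneg nonneg) simp
  define d where "d = min 1 (e / K)"
  have "d * K \<le> e / K * K" using \<open>K > 0\<close> by (intro mult_right_mono) (simp_all add: d_def)
  with \<open>e > 0\<close> \<open>K > 0\<close> have d: "0 < d" "d \<le> 1" "d * K \<le> e"
    by (simp_all add: d_def)
  obtain a b where ab: "pos a" "pos b" "a * b = b * a" "p (g - a * a) \<le> d" "p (h - b * b) \<le> d"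
    using assms \<open>d > 0\<close> by (rule commuting_pos_approx_sqrt)
  have "a * b * (a * b) = a * a * (b * b)" using ab(3) by (metis mult.assoc)
  then have "g * h - a * b * (a * b) = (g - a * a) * h + (a * a) * (h - b * b)"
    by (simp add: left_diff_distrib right_diff_distrib mult.assoc)
  then have "p (g * h - a * b * (a * b)) \<le> p ((g - a * a) * h) + p ((a * a) * (h - b * b))"
    by (simp only: add_le)
  also have "\<dots> \<le> p (g - a * a) * p h + p (a * a) * p (h - b * b)"
    by (intro add_mono mult_le)
  also have "\<dots> \<le> d * p h + (p g + 1) * d"
    using ab(4,5) d(1,2) le_diff_add[of "a * a" g]
    by (intro add_mono mult_mono) (simp_all add: diff_commute[of "a * a"])
  also have "\<dots> \<le> e" using d(3) by (simp add: K_def algebra_simps)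
  finally have "p (g * h - a * b * (a * b)) \<le> e" .
  moreover have "pos (a * b * (a * b))"
    using ab by (intro pos_square) (simp add: star_mult pos_herm)
  ultimately show "\<exists>k. pos k \<and> p (g * h - k) \<le> e" by blast
qed

lemma commuting_pos_le_add:
  assumes "pos g" "pos h" "g * h = h * g"
  shows "p g \<le> p (g + h)"
proof (rule field_le_epsilon)
  fix e :: real assume "e > 0"
  then have "e / 3 > 0" by simp
  with assms obtain a b where ab: "pos a" "pos b" "a * b = b * a"
    "p (g - a * a) \<le> e / 3" "p (h - b * b) \<le> e / 3"
    by (rule commuting_pos_approx_sqrt)
  have "p (a * a) \<le> p (a * a + b * b)"
    using ab by (simp add: square_herm herm_square_le_sum_squares pos_herm)
  also have "a * a + b * b = (g + h) - (g - a * a) - (h - b * b)" by simp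
  also have "p \<dots> \<le> p (g + h) + e / 3 + e / 3"
    using diff_le[of "(g + h) - (g - a * a)" "h - b * b"] diff_le[of "g + h" "g - a * a"] ab(4,5)
    by linarith
  finally show "p g \<le> p (g + h) + e" using le_diff_add[of g "a * a"] ab(4) by simp
qed

lemma pos_le_add:
  assumes "pos g" "pos h"
  shows "p g \<le> p (g + h)"
proof -
  define c where "c = p (g + h)"
  have "pos (scal c - (g + h))"
    using assms by (intro pos_scal_diff_herm) (simp_all add: c_def star_add pos_herm)
  then have "pos ((scal c - (g + h)) + h)" using assms(2) by (rule pos_add)
  then have "p g \<le> p (g + ((scal c - (g + h)) + h))"
    by (intro commuting_pos_le_add assms) (simp_all add: algebra_simps scal_commute[of c g])
  then show ?thesis using scal_le[of c] by (simp add: c_def)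
qed

text \<open>\<open>q\<close> is a polynomial in \<open>y\<^sup>* y\<close>; this replaces the fact that \<open>y\<^sup>* y\<close> and \<open>y y\<^sup>*\<close> have the same
  spectrum apart from \<open>0\<close>.\<close>

lemma scal_add_star_self_power:
  assumes R: "0 \<le> T" "T \<le> R" "p (scal T + star y * y) \<le> R"
  shows "\<exists>q. (scal T + y * star y) ^ n = scal (T ^ n) + y * q * star y \<and> p q * R \<le> n * R ^ n"
proof (induction n)
  case 0
  show ?case by (intro exI[of _ 0]) simp
next
  case (Suc n)
  then obtain q where q: "(scal T + y * star y) ^ n = scal (T ^ n) + y * q * star y"
    "p q * R \<le> n * R ^ n" by blast
  define q' where "q' = scal (T ^ n) + (scal T + star y * y) * q"
  have "scal T * (y * z) = y * (scal T * z)" for z by (metis mult.assoc scal_commute)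
  then have "(scal T + y * star y) ^ Suc n = scal (T ^ Suc n) + y * q' * star y"
    by (simp add: q q'_def algebra_simps scal_mult scal_commute[of "T ^ n" "star y"])
  moreover have "p q' * R \<le> Suc n * R ^ Suc n"
  proof -
    have "p (scal (T ^ n)) \<le> R ^ n"
      using R power_mono[of T R n] scal_le[of "T ^ n"] by simp
    moreover have "p ((scal T + star y * y) * q) \<le> R * p q"
      using R(3) by (intro order_trans[OF mult_le] mult_right_mono nonneg)
    ultimately have "p q' \<le> R ^ n + R * p q"
      unfolding q'_def by (rule order_trans[OF add_le add_mono])
    then have "p q' * R \<le> (R ^ n + R * p q) * R" using R by (intro mult_right_mono) auto
    also have "\<dots> = R ^ Suc n + R * (p q * R)" by (simp add: algebra_simps)
    also have "\<dots> \<le> R ^ Suc n + R * (n * R ^ n)"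
      using R q(2) by (intro add_left_mono mult_left_mono) auto
    finally show ?thesis by (simp add: algebra_simps)
  qed
  ultimately show ?case by blast
qed

lemma scal_add_star_self_swap:
  assumes R: "0 \<le> T" "T \<le> R" "0 < R" "p (scal T + star y * y) \<le> R"
  shows "p (scal T + y * star y) \<le> R"
proof (rule le_of_power_of_2_le[OF R(3)])
  fix k
  obtain q where q: "(scal T + y * star y) ^ 2 ^ k = scal (T ^ 2 ^ k) + y * q * star y"
    "p q * R \<le> 2 ^ k * R ^ 2 ^ k"
    using scal_add_star_self_power[OF R(1,2,4), of "2 ^ k"] by auto
  have "p (scal T + y * star y) ^ 2 ^ k = p (scal (T ^ 2 ^ k) + y * q * star y)"
    unfolding q(1)[symmetric] by (rule power_of_2_herm[symmetric]) (simp add: star_simps)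
  also have "\<dots> \<le> p (scal (T ^ 2 ^ k)) + p (y * q * star y)" by (rule add_le)
  also have "\<dots> \<le> R ^ 2 ^ k + p y * p q * p y"
    using scal_le[of "T ^ 2 ^ k"] power_mono[OF R(2,1), of "2 ^ k"] mult_le[of "y * q" "star y"]
      mult_right_mono[OF mult_le[of y q] nonneg[of y]] R(1) by simp
  finally have "p (scal T + y * star y) ^ 2 ^ k * R \<le> (R ^ 2 ^ k + p y * p q * p y) * R"
    using R(3) by (intro mult_right_mono) auto
  also have "\<dots> = R ^ 2 ^ k * R + (p y)\<^sup>2 * (p q * R)"
    by (simp add: power2_eq_square algebra_simps)
  also have "\<dots> \<le> R ^ 2 ^ k * R + (p y)\<^sup>2 * (2 ^ k * R ^ 2 ^ k)"
    using q(2) by (intro add_left_mono mult_left_mono) auto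
  finally show "p (scal T + y * star y) ^ 2 ^ k * R \<le> R ^ 2 ^ k * (R + 2 ^ k * (p y)\<^sup>2)"
    by (simp add: algebra_simps)
qed

lemma pos_scal_diff_star_self_swap:
  assumes "pos (scal d - star y * y)" "d > 0"
  shows "pos (scal d - y * star y)"
proof -
  obtain S where S: "p (scal S - (scal d - star y * y)) \<le> S" using assms(1) by (auto simp: pos_def)
  define T where "T = max S d"
  have "p (scal (T - d) + star y * y) \<le> T"
    using scal_diff_mono[OF S, of T] by (simp add: T_def scal_diff algebra_simps)
  then have "p (scal (T - d) + y * star y) \<le> T"
    using assms(2) by (intro scal_add_star_self_swap) (auto simp: T_def)
  then have "p (scal T - (scal d - y * star y)) \<le> T" by (simp add: scal_diff algebra_simps)
  then show ?thesis by (rule posI[rotated]) (simp add: star_simps)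
qed

lemma pos_star_self_add_swap: "pos (star y * y + y * star y)"
proof -
  define a where "a = y + star y"
  define b where "b = \<i> *\<^sub>C (star y - y)"
  have "star a = a" "star b = b"
    by (simp_all add: a_def b_def star_simps add.commute cvs.scale_right_diff_distrib)
  then have "pos (complex_of_real (1/2) *\<^sub>C (a * a + b * b))"
    by (intro pos_scale pos_add pos_square) simp_all
  also have "a * a + b * b = 2 *\<^sub>C (star y * y + y * star y)"
    unfolding scaleC_two by (simp add: a_def b_def algebra_simps mult_scaleC_left mult_scaleC_right)
  finally show ?thesis by simp
qed

lemma star_self_le_of_pos_scal_diff:
  assumes "pos (scal d - star y * y)" "d > 0"
  shows "(p y)\<^sup>2 \<le> 3 * d"
proof -
  have "pos ((scal d - y * star y) + (star y * y + y * star y))"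
    by (intro pos_add pos_scal_diff_star_self_swap assms pos_star_self_add_swap)
  then have "pos (scal d + star y * y)" by simp
  from pos_le_add[OF this assms(1)] have "p (scal d + star y * y) \<le> p (scal (2 * d))"
    by (simp flip: scal_add add: algebra_simps)
  with scal_le[of "2 * d"] assms(2) have "p (scal d + star y * y) \<le> 2 * d" by simp
  moreover have "(p y)\<^sup>2 \<le> p (scal d + star y * y) + p (scal d)"
    using diff_le[of "scal d + star y * y" "scal d"] by (simp add: star_self)
  ultimately show ?thesis using scal_le[of d] assms(2) by simp
qed

text \<open>Kaplansky's argument: with \<open>a\<close> close to \<open>\<bar>h\<bar>\<close>, where \<open>h = x\<^sup>* x\<close>, the element \<open>b = a - h\<close> is
  close to twice the negative part of \<open>h\<close>, and \<open>y = x b\<close> satisfies \<open>y\<^sup>* y = h b\<^sup>2 \<approx> - b\<^sup>3 / 2\<close>.\<close>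

lemma diff_approx_abs_star_self_le:
  assumes a: "pos a" "star x * x * a = a * (star x * x)"
    and e: "p (star x * x * (star x * x) - a * a) \<le> e" "e > 0"
  defines "b \<equiv> a - star x * x"
  shows "(p b)\<^sup>2 \<le> 7 * e"
proof (cases "p b = 0")
  case False
  then have "p b > 0" by (simp add: less_le)
  define h where "h = star x * x"
  define r where "r = h * h - a * a"
  define y where "y = x * b"
  have ha: "h * a = a * h" using a(2) by (simp add: h_def)
  have herm: "star h = h" "star a = a" "star b = b" "star r = r"
    using pos_herm[OF a(1)] by (simp_all add: h_def b_def r_def star_simps)
  have h: "h = a - b" by (simp add: b_def h_def)
  have ab: "a * b = b * a" using ha by (simp add: h algebra_simps)
  have ab_left: "a * (b * z) = b * (a * z)" for z by (metis ab mult.assoc)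
  have r: "r = b * b - a * b - a * b" by (simp add: r_def h algebra_simps ab)
  have yy: "star y * y = b * h * b" by (simp add: y_def star_simps herm h_def mult.assoc)
  define d where "d = e * p b"
  have "p (r * b) \<le> d"
    unfolding d_def using e
    by (intro order_trans[OF mult_le] mult_right_mono) (auto simp: r_def h_def)
  have "star (r * b) = r * b" by (simp add: star_simps herm r algebra_simps ab)
  with \<open>p (r * b) \<le> d\<close> have "pos (scal d - - (r * b))"
    by (intro pos_scal_diff_herm) (simp_all add: star_minus)
  moreover have "a * (b * b) = b * b * a" using ab by (metis mult.assoc)
  then have "pos (a * (b * b))" by (intro pos_mult_commuting a(1) pos_square herm)
  moreover have "scal d - star y * y = (scal d - - (r * b)) + a * (b * b)"
    by (simp add: yy h r algebra_simps ab ab_left)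
  ultimately have "pos (scal d - star y * y)" by (simp only: pos_add)
  then have "(p y)\<^sup>2 \<le> 3 * d"
    by (rule star_self_le_of_pos_scal_diff) (use e \<open>p b > 0\<close> in \<open>simp add: d_def\<close>)
  moreover have "b * b * b = - (2 *\<^sub>C (star y * y)) - r * b"
    by (simp add: scaleC_two yy h r algebra_simps ab ab_left)
  then have "p (b * b * b) \<le> 2 * p (star y * y) + p (r * b)"
    using diff_le[of "- (2 *\<^sub>C (star y * y))" "r * b"] by (simp add: scale)
  ultimately have "p (b * b * b) \<le> 7 * d"
    using \<open>p (r * b) \<le> d\<close> by (simp add: star_self)
  then have "p b ^ 3 \<le> 7 * e * p b" using cube_le_herm[OF herm(3)] by (simp add: d_def)
  then show ?thesis using \<open>p b > 0\<close> by (simp add: power2_eq_square power3_eq_cube)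
qed (use e in simp)

lemma pos_star_self: "pos (star x * x)"
proof (rule pos_closed)
  define h where "h = star x * x"
  show "star (star x * x) = star x * x" by (simp add: star_simps)
  fix e :: real assume "e > 0"
  have "pos (h * h)" by (rule pos_square) (simp add: h_def star_simps)
  moreover have "e\<^sup>2 / 7 > 0" using \<open>e > 0\<close> by simp
  ultimately obtain a where a: "pos a" "\<And>c. c * (h * h) = h * h * c \<Longrightarrow> c * a = a * c"
    "p (h * h - a * a) \<le> e\<^sup>2 / 7"
    by (rule pos_approx_sqrt) blast
  have "h * a = a * h" by (rule a(2)) (simp add: mult.assoc)
  with a(1,3) have "(p (a - h))\<^sup>2 \<le> 7 * (e\<^sup>2 / 7)"
    unfolding h_def using \<open>e > 0\<close> by (intro diff_approx_abs_star_self_le) simp_all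
  then have "p (a - h) \<le> e"
    using \<open>e > 0\<close> by (intro power2_le_imp_le[of "p (a - h)" e]) simp_all
  with a(1) show "\<exists>k. pos k \<and> p (star x * x - k) \<le> e"
    by (auto simp: h_def diff_commute[of a])
qed

lemma star_self_le_sum:
  assumes "finite I" "i \<in> I"
  shows "(p (y i))\<^sup>2 \<le> p (\<Sum>j\<in>I. star (y j) * y j)"
proof -
  have "p (star (y i) * y i) \<le> p (star (y i) * y i + (\<Sum>j\<in>I - {i}. star (y j) * y j))"
    by (intro pos_le_add pos_sum pos_star_self)
  then show ?thesis by (simp add: star_self sum.remove[OF assms])
qed

end

lemma cstar_seminorm_SUP:
  fixes P :: "('z::star_alg \<Rightarrow> real) set"
  assumes "P \<noteq> {}" and cstar: "\<And>p. p \<in> P \<Longrightarrow> cstar_seminorm p"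
    and bdd: "\<And>z. bdd_above ((\<lambda>p. p z) ` P)"
  shows "cstar_seminorm (\<lambda>z. SUP p\<in>P. p z)"
proof (rule cstar_seminormI)
  have nonneg: "p z \<ge> 0" if "p \<in> P" for p z
    using cstar[OF that] by (intro cstar_seminormed.nonneg) (rule cstar_seminormed.intro)
  define q where "q z = (SUP p\<in>P. p z)" for z
  have upper: "p z \<le> q z" if "p \<in> P" for p z
    unfolding q_def using that by (intro cSUP_upper bdd)
  have least: "q z \<le> K" if "\<And>p. p \<in> P \<Longrightarrow> p z \<le> K" for z K
    unfolding q_def using that by (intro cSUP_least assms(1))
  have q_nonneg: "q z \<ge> 0" for z
    using assms(1) nonneg upper order_trans by (metis ex_in_conv)
  fix x y c
  have "q (x + y) \<le> q x + q y"
    using cstar upper by (intro least) (meson add_mono cstar_seminorm_def order_trans)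
  moreover have "q (c *\<^sub>C x) \<le> cmod c * q x"
    using cstar upper by (intro least) (metis cstar_seminorm_def mult_left_mono norm_ge_zero)
  moreover have "q (x * y) \<le> q x * q y"
    using cstar upper nonneg q_nonneg
    by (intro least) (meson cstar_seminorm_def mult_mono order_trans)
  moreover have "q x \<le> sqrt (q (star x * x))"
    using cstar upper by (intro least real_le_rsqrt) (metis cstar_seminorm_def)
  then have "(q x)\<^sup>2 \<le> (sqrt (q (star x * x)))\<^sup>2" by (intro power_mono q_nonneg)
  then have "(q x)\<^sup>2 \<le> q (star x * x)" by (simp add: q_nonneg)
  ultimately show "(SUP p\<in>P. p (x + y)) \<le> (SUP p\<in>P. p x) + (SUP p\<in>P. p y)"
    "(SUP p\<in>P. p (c *\<^sub>C x)) \<le> cmod c * (SUP p\<in>P. p x)"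
    "(SUP p\<in>P. p (x * y)) \<le> (SUP p\<in>P. p x) * (SUP p\<in>P. p y)"
    "(SUP p\<in>P. p x)\<^sup>2 \<le> (SUP p\<in>P. p (star x * x))"
    by (simp_all add: q_def)
qed

lemma cstar_norm_SUP:
  fixes q :: "'z::star_alg \<Rightarrow> real"
  assumes q: "cstar_norm q" and bdd: "\<And>z :: 'z. bdd_above {p z |p. cstar_seminorm p}"
  shows "cstar_norm (\<lambda>z :: 'z. SUP p\<in>{p. cstar_seminorm p}. p z)"
  unfolding cstar_norm_def
proof (intro conjI allI impI)
  have q_mem: "q \<in> {p. cstar_seminorm p}" using q by (simp add: cstar_norm_def)
  have bdd_image: "bdd_above ((\<lambda>p. p z) ` {p. cstar_seminorm p})" for z :: 'z
    using bdd[of z] by (simp add: image_Collect)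
  show "cstar_seminorm (\<lambda>z :: 'z. SUP p\<in>{p. cstar_seminorm p}. p z)"
    by (rule cstar_seminorm_SUP) (use q_mem bdd_image in auto)
  fix x :: 'z assume "(SUP p\<in>{p. cstar_seminorm p}. p x) = 0"
  then have "q x \<le> 0" using cSUP_upper[OF q_mem bdd_image, of x] by simp
  moreover have "q x \<ge> 0"
    using q_mem by (intro cstar_seminormed.nonneg cstar_seminormed.intro) simp
  ultimately show "x = 0" using q by (simp add: cstar_norm_def)
qed

definition uniformly_bounded_elements :: "'z::star_alg set" where
  "uniformly_bounded_elements = {z. bdd_above {p z |p. cstar_seminorm p}}"

lemma uniformly_bounded_elements_iff:
  "z \<in> uniformly_bounded_elements \<longleftrightarrow> (\<exists>K. \<forall>p. cstar_seminorm p \<longrightarrow> p z \<le> K)"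
  by (auto simp: uniformly_bounded_elements_def bdd_above_def)

lemma subspace_uniformly_bounded_elements:
  "cvs.subspace (uniformly_bounded_elements :: 'z::star_alg set)"
proof (rule cvs.subspaceI)
  have "p 0 \<le> 0" if "cstar_seminorm p" for p :: "'z \<Rightarrow> real"
    using cstar_seminormed.zero[OF cstar_seminormed.intro[OF that]] by simp
  then show "(0 :: 'z) \<in> uniformly_bounded_elements"
    unfolding uniformly_bounded_elements_iff by blast
next
  fix x y :: 'z assume "x \<in> uniformly_bounded_elements" "y \<in> uniformly_bounded_elements"
  then obtain K L where "\<And>p. cstar_seminorm p \<Longrightarrow> p x \<le> K" "\<And>p. cstar_seminorm p \<Longrightarrow> p y \<le> L"
    unfolding uniformly_bounded_elements_iff by blast
  then have "p (x + y) \<le> K + L" if "cstar_seminorm p" for p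
    using that cstar_seminormed.add_le[OF cstar_seminormed.intro[OF that]]
    by (meson add_mono order_trans)
  then show "x + y \<in> uniformly_bounded_elements" unfolding uniformly_bounded_elements_iff by blast
next
  fix c and x :: 'z assume "x \<in> uniformly_bounded_elements"
  then obtain K where K: "\<And>p. cstar_seminorm p \<Longrightarrow> p x \<le> K"
    unfolding uniformly_bounded_elements_iff by blast
  have "p (c *\<^sub>C x) \<le> cmod c * K" if "cstar_seminorm p" for p
    using cstar_seminormed.scale[OF cstar_seminormed.intro[OF that]] K[OF that]
    by (simp add: mult_left_mono)
  then show "c *\<^sub>C x \<in> uniformly_bounded_elements" unfolding uniformly_bounded_elements_iff by blast
qed

lemma sum_star_self_uniformly_bounded:
  fixes y :: "'i \<Rightarrow> 'z::star_alg"
  assumes "finite I" "(\<Sum>i\<in>I. star (y i) * y i) = scal c" "i \<in> I"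
  shows "y i \<in> uniformly_bounded_elements"
proof -
  have "p (y i) \<le> sqrt \<bar>c\<bar>" if "cstar_seminorm p" for p :: "'z \<Rightarrow> real"
  proof -
    interpret cstar_seminormed p using that by (rule cstar_seminormed.intro)
    have "(p (y i))\<^sup>2 \<le> \<bar>c\<bar>"
      using star_self_le_sum[OF assms(1,3), of y] scal_le[of c] by (simp add: assms(2))
    then show ?thesis by (rule real_le_rsqrt)
  qed
  then show ?thesis unfolding uniformly_bounded_elements_iff by blast
qed

section \<open>Hermitian forms\<close>

instance complex :: calg
  by standard (simp_all add: scaleC_complex_def)

instantiation complex :: star_alg
begin
definition star_complex :: "complex \<Rightarrow> complex" where
  "star_complex = cnj"
instance by standard (simp_all add: star_complex_def scaleC_complex_def)
end

definition herm_form ::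
  "nat \<Rightarrow> (nat \<Rightarrow> nat \<Rightarrow> complex) \<Rightarrow> (nat \<Rightarrow> 'z::star_alg) \<Rightarrow> 'z" where
  "herm_form n F e = (\<Sum>i<n. \<Sum>j<n. F i j *\<^sub>C (star (e i) * e j))"

definition posdef :: "nat \<Rightarrow> (nat \<Rightarrow> nat \<Rightarrow> complex) \<Rightarrow> bool" where
  "posdef n F \<longleftrightarrow> (\<forall>i<n. \<forall>j<n. F j i = cnj (F i j)) \<and>
     (\<forall>x. (\<exists>i<n. x i \<noteq> 0) \<longrightarrow> Re (herm_form n F x) > 0)"

definition schur_complement :: "nat \<Rightarrow> (nat \<Rightarrow> nat \<Rightarrow> complex) \<Rightarrow> nat \<Rightarrow> nat \<Rightarrow> complex" where
  "schur_complement n F i j = F i j - F i n * F n j / F n n"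

lemma herm_form_cong: "(\<And>i. i < n \<Longrightarrow> e i = e' i) \<Longrightarrow> herm_form n F e = herm_form n F e'"
  by (simp add: herm_form_def)

lemma posdef_herm: "posdef n F \<Longrightarrow> i < n \<Longrightarrow> j < n \<Longrightarrow> F j i = cnj (F i j)"
  unfolding posdef_def by blast

lemma posdef_diag:
  assumes "posdef (Suc n) F"
  shows "F n n = complex_of_real (Re (F n n))" and "Re (F n n) > 0"
proof -
  show "F n n = complex_of_real (Re (F n n))"
    using posdef_herm[OF assms, of n n] by (simp add: complex_eq_iff)
  have "herm_form (Suc n) F (\<lambda>i. of_bool (i = n)) = F n n"
    by (simp add: herm_form_def star_complex_def scaleC_complex_def sum_distrib_left[symmetric])
  moreover have "Re (herm_form (Suc n) F (\<lambda>i. of_bool (i = n))) > 0"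
    using assms unfolding posdef_def by force
  ultimately show "Re (F n n) > 0" by simp
qed

lemma herm_form_Suc:
  assumes F: "posdef (Suc n) F"
  defines "y \<equiv> \<lambda>e :: nat \<Rightarrow> 'z::star_alg. e n + (\<Sum>j<n. (F n j / F n n) *\<^sub>C e j)"
  shows "herm_form (Suc n) F e = F n n *\<^sub>C (star (y e) * y e) + herm_form n (schur_complement n F) e"
proof -
  have d: "F n n \<noteq> 0" "cnj (F n n) = F n n"
    using posdef_diag(2)[OF F] posdef_herm[OF F, of n n] by auto
  define q where "q = (\<Sum>j<n. (F n j / F n n) *\<^sub>C e j)"
  have "cnj (F n i) = F i n" if "i < n" for i
    using posdef_herm[OF F, of n i] that by simp
  then have star_q: "star q = (\<Sum>i<n. (F i n / F n n) *\<^sub>C star (e i))"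
    unfolding q_def star_sum by (intro sum.cong) (simp_all add: star_scaleC d)
  have en_q: "F n n *\<^sub>C (star (e n) * q) = (\<Sum>j<n. F n j *\<^sub>C (star (e n) * e j))"
    using d by (simp add: q_def sum_distrib_left cvs.scale_sum_right mult_scaleC_right)
  have q_en: "F n n *\<^sub>C (star q * e n) = (\<Sum>i<n. F i n *\<^sub>C (star (e i) * e n))"
    using d by (simp add: star_q sum_distrib_right cvs.scale_sum_right mult_scaleC_left)
  have "F n n *\<^sub>C (star q * q) = (\<Sum>i<n. (F i n / F n n) *\<^sub>C (star (e i) * (F n n *\<^sub>C q)))"
    by (simp add: star_q sum_distrib_right cvs.scale_sum_right mult_scaleC_left mult_scaleC_right
        mult.commute)
  also have "\<dots> = (\<Sum>i<n. \<Sum>j<n. (F i n * F n j / F n n) *\<^sub>C (star (e i) * e j))"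
    using d by (simp add: q_def sum_distrib_left cvs.scale_sum_right mult_scaleC_right)
  finally have "herm_form n (schur_complement n F) e = herm_form n F e - F n n *\<^sub>C (star q * q)"
    by (simp add: herm_form_def schur_complement_def cvs.scale_left_diff_distrib sum_subtractf)
  moreover have "F n n *\<^sub>C (star (y e) * y e) =
      F n n *\<^sub>C (star (e n) * e n) + F n n *\<^sub>C (star (e n) * q)
      + F n n *\<^sub>C (star q * e n) + F n n *\<^sub>C (star q * q)"
    unfolding y_def q_def[symmetric]
    by (simp add: star_add distrib_left distrib_right scaleC_add_right add_ac)
  moreover have "herm_form (Suc n) F e = herm_form n F e + F n n *\<^sub>C (star q * e n)
      + F n n *\<^sub>C (star (e n) * q) + F n n *\<^sub>C (star (e n) * e n)"
    unfolding en_q q_en by (simp add: herm_form_def sum.distrib add_ac)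
  ultimately show ?thesis by simp
qed

lemma posdef_schur_complement:
  assumes F: "posdef (Suc n) F"
  shows "posdef n (schur_complement n F)"
  unfolding posdef_def
proof (intro conjI allI impI)
  fix i j assume "i < n" "j < n"
  then have "cnj (F i j) = F j i" "cnj (F n j) = F j n" "cnj (F i n) = F n i" "cnj (F n n) = F n n"
    by (simp_all flip: posdef_herm[OF F])
  then show "schur_complement n F j i = cnj (schur_complement n F i j)"
    by (simp add: schur_complement_def)
next
  fix x :: "nat \<Rightarrow> complex" assume "\<exists>i<n. x i \<noteq> 0"
  define x' where "x' = x(n := - (\<Sum>j<n. (F n j / F n n) *\<^sub>C x j))"
  have "herm_form (Suc n) F x' = herm_form n (schur_complement n F) x'"
    unfolding herm_form_Suc[OF F] by (simp add: x'_def)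
  also have "\<dots> = herm_form n (schur_complement n F) x"
    by (rule herm_form_cong) (simp add: x'_def)
  finally have "herm_form n (schur_complement n F) x = herm_form (Suc n) F x'" ..
  moreover have "\<exists>i<Suc n. x' i \<noteq> 0"
    using \<open>\<exists>i<n. x i \<noteq> 0\<close> by (auto simp: x'_def intro: less_SucI)
  ultimately show "Re (herm_form n (schur_complement n F) x) > 0"
    using F by (simp add: posdef_def)
qed

lemma posdef_herm_form_sum_of_squares:
  fixes e :: "nat \<Rightarrow> 'z::star_alg"
  assumes "posdef n F"
  shows "\<exists>y. herm_form n F e = (\<Sum>k<n. star (y k) * y k) \<and> e ` {..<n} \<subseteq> cvs.span (y ` {..<n})"
  using assms
proof (induction n arbitrary: F)
  case 0
  show ?case by (simp add: herm_form_def)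
next
  case (Suc n)
  define d where "d = Re (F n n)"
  have d: "d > 0" "F n n = complex_of_real d"
    unfolding d_def using posdef_diag[OF Suc.prems] by blast+
  define y0 where "y0 = e n + (\<Sum>j<n. (F n j / F n n) *\<^sub>C e j)"
  obtain y where y: "herm_form n (schur_complement n F) e = (\<Sum>k<n. star (y k) * y k)"
    "e ` {..<n} \<subseteq> cvs.span (y ` {..<n})"
    using Suc.IH[OF posdef_schur_complement[OF Suc.prems]] by blast
  define y' where "y' = y(n := complex_of_real (sqrt d) *\<^sub>C y0)"
  let ?V = "cvs.span (y' ` {..<Suc n})"
  have "star (y' n) * y' n = F n n *\<^sub>C (star y0 * y0)"
    using d(1)
    by (simp add: y'_def star_scaleC mult_scaleC_left mult_scaleC_right d(2) flip: of_real_mult)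
  then have "herm_form (Suc n) F e = (\<Sum>k<Suc n. star (y' k) * y' k)"
    by (simp add: herm_form_Suc[OF Suc.prems] y(1) y0_def[symmetric]) (simp add: y'_def)
  moreover have e: "e j \<in> ?V" if "j < n" for j
  proof -
    have "y ` {..<n} \<subseteq> y' ` {..<Suc n}" by (auto simp: y'_def)
    then show ?thesis using y(2) that cvs.span_mono by blast
  qed
  moreover have "e n \<in> ?V"
  proof -
    have "complex_of_real (1 / sqrt d) *\<^sub>C y' n \<in> ?V"
      by (intro cvs.span_scale cvs.span_base) simp
    then have "y0 \<in> ?V" using d(1) by (simp add: y'_def)
    then have "y0 - (\<Sum>j<n. (F n j / F n n) *\<^sub>C e j) \<in> ?V"
      by (intro cvs.span_diff cvs.span_sum cvs.span_scale e) simp_all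
    then show ?thesis by (simp add: y0_def)
  qed
  ultimately show ?case by (intro exI[of _ y']) (auto simp: less_Suc_eq simp del: sum.lessThan_Suc)
qed

section \<open>The GNS seminorm of a positive functional\<close>

locale positive_form =
  fixes \<mu> :: "'z::star_alg \<Rightarrow> complex"
  assumes clinear: "clinear \<mu>" and positive: "positive_functional \<mu>"
begin

lemma zero [simp]: "\<mu> 0 = 0"
  and add: "\<mu> (x + y) = \<mu> x + \<mu> y"
  and scale: "\<mu> (c *\<^sub>C x) = c * \<mu> x"
  using clinear by (simp_all add: cvs.linear_0 clinear_iff scaleC_complex_def)

lemma sum: "\<mu> (sum f A) = (\<Sum>i\<in>A. \<mu> (f i))"
  by (rule cvs.linear_sum[OF clinear])

lemma star_self_nonneg: "Re (\<mu> (star x * x)) \<ge> 0"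
  and star_self_real: "Im (\<mu> (star x * x)) = 0"
  using positive by (simp_all add: positive_functional_def)

lemma star_self_expand:
  "\<mu> (star (x + c *\<^sub>C y) * (x + c *\<^sub>C y)) =
    \<mu> (star x * x) + c * \<mu> (star x * y) + cnj c * \<mu> (star y * x) + (cnj c * c) * \<mu> (star y * y)"
  by (simp add: star_add star_scaleC distrib_left distrib_right mult_scaleC_left mult_scaleC_right
      add scale algebra_simps)

lemma cnj_star_mult: "cnj (\<mu> (star x * y)) = \<mu> (star y * x)"
proof (rule complex_eqI)
  show "Im (cnj (\<mu> (star x * y))) = Im (\<mu> (star y * x))"
    using star_self_real[of "x + 1 *\<^sub>C y"] unfolding star_self_expand by (simp add: star_self_real)
  show "Re (cnj (\<mu> (star x * y))) = Re (\<mu> (star y * x))"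
    using star_self_real[of "x + \<i> *\<^sub>C y"] unfolding star_self_expand by (simp add: star_self_real)
qed

definition gns_norm :: "'z \<Rightarrow> real" where
  "gns_norm x = sqrt (Re (\<mu> (star x * x)))"

lemma gns_norm_nonneg [simp]: "gns_norm x \<ge> 0"
  and gns_norm_square: "(gns_norm x)\<^sup>2 = Re (\<mu> (star x * x))"
  using star_self_nonneg[of x] by (simp_all add: gns_norm_def)

lemma gns_norm_0 [simp]: "gns_norm 0 = 0"
  by (simp add: gns_norm_def)

lemma gns_norm_scale: "gns_norm (c *\<^sub>C x) = cmod c * gns_norm x"
proof -
  have "\<mu> (star (c *\<^sub>C x) * (c *\<^sub>C x)) = complex_of_real ((cmod c)\<^sup>2) * \<mu> (star x * x)"
    unfolding complex_norm_square
    by (simp add: star_scaleC mult_scaleC_left mult_scaleC_right scale)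
  then show ?thesis by (simp add: gns_norm_def real_sqrt_mult)
qed

lemma Cauchy_Schwarz: "cmod (\<mu> (star x * y)) \<le> gns_norm x * gns_norm y"
proof -
  define b where "b = \<mu> (star x * y)"
  define A B where "A = (gns_norm x)\<^sup>2" and "B = (gns_norm y)\<^sup>2"
  have quadratic: "0 \<le> A - 2 * t * (cmod b)\<^sup>2 + t\<^sup>2 * (cmod b)\<^sup>2 * B" for t :: real
  proof -
    have "\<mu> (star (x + (- t * cnj b) *\<^sub>C y) * (x + (- t * cnj b) *\<^sub>C y)) =
       \<mu> (star x * x) - 2 * t * (b * cnj b) + t\<^sup>2 * (b * cnj b) * \<mu> (star y * y)"
      unfolding star_self_expand cnj_star_mult[of x y, symmetric] b_def[symmetric]
      by (simp add: algebra_simps power2_eq_square)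
    with star_self_nonneg[of "x + (- t * cnj b) *\<^sub>C y"] show ?thesis
      by (simp add: A_def B_def gns_norm_square flip: complex_norm_square)
  qed
  have "(cmod b)\<^sup>2 \<le> A * B"
  proof (cases "B = 0")
    case True
    have "b = 0"
    proof (rule ccontr)
      assume "b \<noteq> 0"
      then have "0 \<le> A - 2 * (A + 1)" using quadratic[of "(A + 1) / (cmod b)\<^sup>2"] True by simp
      moreover have "A \<ge> 0" by (simp add: A_def)
      ultimately show False by simp
    qed
    with True show ?thesis by simp
  next
    case False
    then have "B > 0" by (simp add: B_def)
    then show ?thesis using quadratic[of "1 / B"] by (simp add: field_simps power2_eq_square)
  qed
  then have "(cmod b)\<^sup>2 \<le> (gns_norm x * gns_norm y)\<^sup>2"
    by (simp add: A_def B_def power_mult_distrib)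
  then show ?thesis unfolding b_def by (rule power2_le_imp_le) simp
qed

lemma gns_norm_triangle: "gns_norm (x + y) \<le> gns_norm x + gns_norm y"
proof (rule power2_le_imp_le)
  have "(gns_norm (x + y))\<^sup>2 = (gns_norm x)\<^sup>2 + 2 * Re (\<mu> (star x * y)) + (gns_norm y)\<^sup>2"
    unfolding gns_norm_square
    using star_self_expand[of x 1 y] cnj_star_mult[of x y, symmetric] by simp
  also have "\<dots> \<le> (gns_norm x + gns_norm y)\<^sup>2"
    using Cauchy_Schwarz[of x y] complex_Re_le_cmod[of "\<mu> (star x * y)"]
    by (simp add: power2_sum)
  finally show "(gns_norm (x + y))\<^sup>2 \<le> (gns_norm x + gns_norm y)\<^sup>2" .
qed simp

definition bounded_elements :: "'z set" where
  "bounded_elements = {z. \<exists>K. \<forall>w. gns_norm (z * w) \<le> K * gns_norm w}"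

lemma subspace_bounded_elements: "cvs.subspace bounded_elements"
proof (rule cvs.subspaceI)
  show "0 \<in> bounded_elements" by (auto simp: bounded_elements_def intro: exI[of _ 0])
next
  fix x y assume "x \<in> bounded_elements" "y \<in> bounded_elements"
  then obtain K L where
    "\<And>w. gns_norm (x * w) \<le> K * gns_norm w" "\<And>w. gns_norm (y * w) \<le> L * gns_norm w"
    by (auto simp: bounded_elements_def)
  then have "gns_norm ((x + y) * w) \<le> (K + L) * gns_norm w" for w
    unfolding distrib_right by (rule order_trans[OF gns_norm_triangle add_mono])
  then show "x + y \<in> bounded_elements" by (auto simp: bounded_elements_def)
next
  fix c x assume "x \<in> bounded_elements"
  then obtain K where K: "\<And>w. gns_norm (x * w) \<le> K * gns_norm w"
    by (auto simp: bounded_elements_def)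
  have "gns_norm ((c *\<^sub>C x) * w) \<le> (cmod c * K) * gns_norm w" for w
    using mult_left_mono[OF K[of w], of "cmod c"]
    by (simp add: mult_scaleC_left gns_norm_scale mult.assoc)
  then show "c *\<^sub>C x \<in> bounded_elements" by (auto simp: bounded_elements_def)
qed

lemma sum_star_self_bounded_elements:
  assumes "finite I" "(\<Sum>i\<in>I. star (y i) * y i) = scal c" "i \<in> I"
  shows "y i \<in> bounded_elements"
proof -
  have "gns_norm (y i * w) \<le> sqrt c * gns_norm w" for w
  proof -
    have "(\<Sum>j\<in>I. star (y j * w) * (y j * w)) = star w * (\<Sum>j\<in>I. star (y j) * y j) * w"
      by (simp add: star_mult mult.assoc sum_distrib_left sum_distrib_right)
    also have "\<dots> = complex_of_real c *\<^sub>C (star w * w)"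
      by (simp add: assms(2) scal_def mult_scaleC_left mult_scaleC_right)
    finally have "(\<Sum>j\<in>I. \<mu> (star (y j * w) * (y j * w))) = complex_of_real c * \<mu> (star w * w)"
      by (simp add: scale flip: sum)
    then have "(\<Sum>j\<in>I. (gns_norm (y j * w))\<^sup>2) = c * (gns_norm w)\<^sup>2"
      unfolding gns_norm_square by (simp flip: Re_sum)
    moreover have "(gns_norm (y i * w))\<^sup>2 \<le> (\<Sum>j\<in>I. (gns_norm (y j * w))\<^sup>2)"
      using assms(1,3) by (intro member_le_sum) simp_all
    ultimately have "sqrt ((gns_norm (y i * w))\<^sup>2) \<le> sqrt (c * (gns_norm w)\<^sup>2)"
      by (simp only: real_sqrt_le_iff)
    then show ?thesis by (simp add: real_sqrt_mult)
  qed
  then show ?thesis by (auto simp: bounded_elements_def)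
qed

definition gns_opnorm :: "'z \<Rightarrow> real" where
  "gns_opnorm z = (SUP w\<in>{w. gns_norm w \<le> 1}. gns_norm (z * w))"

lemma gns_opnorm_le:
  assumes "\<And>w. gns_norm (z * w) \<le> K * gns_norm w" "K \<ge> 0"
  shows "gns_opnorm z \<le> K"
  unfolding gns_opnorm_def
proof (rule cSUP_least)
  show "{w. gns_norm w \<le> 1} \<noteq> {}" by (auto intro: exI[of _ 0])
  show "gns_norm (z * w) \<le> K" if "w \<in> {w. gns_norm w \<le> 1}" for w
    using assms(1)[of w] mult_left_mono[of "gns_norm w" 1 K] that assms(2) by simp
qed

lemma gns_opnorm_bound:
  assumes "z \<in> bounded_elements"
  shows "gns_norm (z * w) \<le> gns_opnorm z * gns_norm w" and "gns_opnorm z \<ge> 0"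
proof -
  obtain K where K: "\<And>w. gns_norm (z * w) \<le> K * gns_norm w"
    using assms by (auto simp: bounded_elements_def)
  have bdd: "bdd_above ((\<lambda>w. gns_norm (z * w)) ` {w. gns_norm w \<le> 1})"
  proof (rule bdd_aboveI2)
    fix w assume "w \<in> {w. gns_norm w \<le> 1}"
    then have "\<bar>K\<bar> * gns_norm w \<le> \<bar>K\<bar> * 1" by (intro mult_left_mono) simp_all
    moreover have "K * gns_norm w \<le> \<bar>K\<bar> * gns_norm w" by (intro mult_right_mono) simp_all
    ultimately show "gns_norm (z * w) \<le> \<bar>K\<bar>" using K[of w] by linarith
  qed
  have unit: "gns_norm (z * w) \<le> gns_opnorm z" if "gns_norm w \<le> 1" for w
    unfolding gns_opnorm_def using that by (intro cSUP_upper bdd) simp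
  from unit[of 0] show "gns_opnorm z \<ge> 0" by simp
  show "gns_norm (z * w) \<le> gns_opnorm z * gns_norm w"
  proof (cases "gns_norm w = 0")
    case True
    then show ?thesis using K[of w] by simp
  next
    case False
    then have "gns_norm w > 0" by (simp add: less_le)
    then show ?thesis using unit[of "complex_of_real (1 / gns_norm w) *\<^sub>C w"]
      by (simp add: mult_scaleC_right gns_norm_scale norm_divide field_simps)
  qed
qed

lemma cstar_seminorm_gns_opnorm:
  assumes "bounded_elements = UNIV"
  shows "cstar_seminorm gns_opnorm"
proof (rule cstar_seminormI)
  note bound = gns_opnorm_bound(1)[unfolded assms, OF UNIV_I]
    and nonneg [simp] = gns_opnorm_bound(2)[unfolded assms, OF UNIV_I]
  fix x y c
  show "gns_opnorm (x + y) \<le> gns_opnorm x + gns_opnorm y"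
  proof (rule gns_opnorm_le)
    show "gns_norm ((x + y) * w) \<le> (gns_opnorm x + gns_opnorm y) * gns_norm w" for w
      unfolding distrib_right by (rule order_trans[OF gns_norm_triangle add_mono[OF bound bound]])
  qed simp
  show "gns_opnorm (c *\<^sub>C x) \<le> cmod c * gns_opnorm x"
  proof (rule gns_opnorm_le)
    show "gns_norm (c *\<^sub>C x * w) \<le> cmod c * gns_opnorm x * gns_norm w" for w
      using mult_left_mono[OF bound[of x w], of "cmod c"]
      by (simp add: mult_scaleC_left gns_norm_scale mult.assoc)
  qed simp
  show "gns_opnorm (x * y) \<le> gns_opnorm x * gns_opnorm y"
  proof (rule gns_opnorm_le)
    show "gns_norm (x * y * w) \<le> gns_opnorm x * gns_opnorm y * gns_norm w" for w
      using bound[of x "y * w"] mult_left_mono[OF bound[of y w] nonneg[of x]]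
      by (simp add: mult.assoc)
  qed simp
  have "gns_opnorm x \<le> sqrt (gns_opnorm (star x * x))"
  proof (rule gns_opnorm_le)
    fix w
    have "(gns_norm (x * w))\<^sup>2 = Re (\<mu> (star w * (star x * x * w)))"
      by (simp add: gns_norm_square star_mult mult.assoc)
    also have "\<dots> \<le> gns_norm w * gns_norm (star x * x * w)"
      by (rule order_trans[OF complex_Re_le_cmod Cauchy_Schwarz])
    also have "\<dots> \<le> gns_norm w * (gns_opnorm (star x * x) * gns_norm w)"
      by (intro mult_left_mono bound) simp
    also have "\<dots> = (sqrt (gns_opnorm (star x * x)) * gns_norm w)\<^sup>2"
      by (simp add: power_mult_distrib) (simp add: power2_eq_square)
    finally show "gns_norm (x * w) \<le> sqrt (gns_opnorm (star x * x)) * gns_norm w"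
      by (rule power2_le_imp_le) simp
  qed simp
  then have "(gns_opnorm x)\<^sup>2 \<le> (sqrt (gns_opnorm (star x * x)))\<^sup>2" by (intro power_mono) simp_all
  then show "(gns_opnorm x)\<^sup>2 \<le> gns_opnorm (star x * x)" by simp
qed

end

section \<open>Comodules of a Hopf *-algebra\<close>

lemma sum_swap_pairs:
  "(\<Sum>i\<in>A. \<Sum>j\<in>B. \<Sum>k\<in>C. \<Sum>l\<in>D. f i j k l) = (\<Sum>k\<in>C. \<Sum>l\<in>D. \<Sum>i\<in>A. \<Sum>j\<in>B. f i j k l)"
proof -
  have "(\<Sum>(i, j)\<in>A \<times> B. \<Sum>(k, l)\<in>C \<times> D. f i j k l) = (\<Sum>(k, l)\<in>C \<times> D. \<Sum>(i, j)\<in>A \<times> B. f i j k l)"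
    unfolding case_prod_unfold by (rule sum.swap)
  then show ?thesis by (simp flip: sum.cartesian_product)
qed

lemma cnj_sum_list: "cnj (\<Sum>x\<leftarrow>xs. h x) = (\<Sum>x\<leftarrow>xs. cnj (h x))"
  by (induction xs) simp_all

lemma clinear_cnj_star: "clinear f \<Longrightarrow> clinear (\<lambda>x. cnj (f (star x)))"
  for f :: "'b::star_alg \<Rightarrow> complex"
  by (simp add: clinear_iff star_add star_scaleC scaleC_complex_def)

lemma teq_map_star:
  assumes "teq xs ys"
  shows "teq (map (\<lambda>(a, b). (star a, star b)) xs) (map (\<lambda>(a, b). (star a, star b)) ys)"
  unfolding teq_iff_clinear
proof (intro allI impI)
  fix f :: "'a \<Rightarrow> complex" and g :: "'b \<Rightarrow> complex" assume "clinear f" "clinear g"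
  then have "cnj (\<Sum>(v, w)\<leftarrow>xs. cnj (f (star v)) * cnj (g (star w))) =
      cnj (\<Sum>(v, w)\<leftarrow>ys. cnj (f (star v)) * cnj (g (star w)))"
    using assms clinear_cnj_star unfolding teq_iff_clinear by metis
  then show "(\<Sum>(v, w)\<leftarrow>map (\<lambda>(a, b). (star a, star b)) xs. f v * g w) =
      (\<Sum>(v, w)\<leftarrow>map (\<lambda>(a, b). (star a, star b)) ys. f v * g w)"
    by (simp add: cnj_sum_list case_prod_unfold o_def)
qed

lemma clinear_tensor_star_hom:
  assumes "tensor_star_hom F" "cbilinear B"
  shows "clinear (\<lambda>x. \<Sum>(a, b)\<leftarrow>F x. B a b)"
proof (rule clinearI)
  fix x y c
  have "teq (F (x + y)) (F x @ F y)" "teq (F (c *\<^sub>C x)) (map (\<lambda>(a, b). (c *\<^sub>C a, b)) (F x))"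
    using assms(1) by (simp_all add: tensor_star_hom_def)
  from this[THEN teq_cbilinear, OF assms(2)]
  show "(\<Sum>(a, b)\<leftarrow>F (x + y). B a b) = (\<Sum>(a, b)\<leftarrow>F x. B a b) + (\<Sum>(a, b)\<leftarrow>F y. B a b)"
    "(\<Sum>(a, b)\<leftarrow>F (c *\<^sub>C x). B a b) = c *\<^sub>C (\<Sum>(a, b)\<leftarrow>F x. B a b)"
    by (simp_all add: o_def case_prod_unfold scaleC_sum_list
        cvs.linear_scale[OF cbilinear_left[OF assms(2)]])
qed

lemma tensor_star_hom_mult:
  assumes "tensor_star_hom F" "cbilinear B"
  shows "(\<Sum>(a, b)\<leftarrow>F (x * y). B a b) = (\<Sum>(a, b)\<leftarrow>F x. \<Sum>(a', b')\<leftarrow>F y. B (a * a') (b * b'))"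
proof -
  have "teq (F (x * y)) (tmul (F x) (F y))" using assms(1) by (simp add: tensor_star_hom_def)
  from teq_cbilinear[OF this assms(2)] show ?thesis
    by (simp add: tmul_def sum_list_concat_map o_def case_prod_unfold)
qed

definition corep_matrix ::
  "('a::star_alg \<Rightarrow> ('a \<times> 'a) list) \<Rightarrow> ('a \<Rightarrow> complex) \<Rightarrow> nat \<Rightarrow> (nat \<Rightarrow> nat \<Rightarrow> 'a) \<Rightarrow> bool" where
  "corep_matrix \<Delta> \<epsilon> n u \<longleftrightarrow> (\<forall>i<n. \<forall>j<n.
     teq (\<Delta> (u i j)) (map (\<lambda>k. (u i k, u k j)) [0..<n]) \<and> \<epsilon> (u i j) = of_bool (i = j))"

definition unit_vec :: "nat \<Rightarrow> nat \<Rightarrow> complex" where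
  "unit_vec i = (\<lambda>j. of_bool (j = i))"

definition mat_vec :: "nat \<Rightarrow> (nat \<Rightarrow> nat \<Rightarrow> 'a::cvec) \<Rightarrow> (nat \<Rightarrow> complex) \<Rightarrow> nat \<Rightarrow> 'a" where
  "mat_vec n u v i = (\<Sum>k<n. v k *\<^sub>C u i k)"

definition matrix_coaction ::
  "nat \<Rightarrow> (nat \<Rightarrow> nat \<Rightarrow> 'a::cvec) \<Rightarrow> (nat \<Rightarrow> complex) \<Rightarrow> ((nat \<Rightarrow> complex) \<times> 'a) list" where
  "matrix_coaction n u v = map (\<lambda>i. (unit_vec i, mat_vec n u v i)) [0..<n]"

lemma unit_vec_in_cspace [simp]: "i < n \<Longrightarrow> unit_vec i \<in> cspace n"
  by (simp add: unit_vec_def cspace_def)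

lemma subspace_cspace: "cvs.subspace (cspace n)"
  by (rule cvs.subspaceI) (simp_all add: cspace_def scaleC_fun_def)

lemma sum_fun_apply: "(\<Sum>i\<in>I. f i) x = (\<Sum>i\<in>I. f i x)"
  by (induction I rule: infinite_finite_induct) simp_all

lemma sum_unit_vec:
  assumes "v \<in> cspace n"
  shows "(\<Sum>i<n. v i *\<^sub>C unit_vec i) = v"
proof
  show "(\<Sum>i<n. v i *\<^sub>C unit_vec i) j = v j" for j
    using assms
    by (cases "j < n") (simp_all add: sum_fun_apply scaleC_fun_def scaleC_complex_def unit_vec_def
        cspace_def of_bool_def if_distrib[of "(*) _"] cong: if_cong)
qed

lemma clinear_mat_vec: "clinear (\<lambda>v. mat_vec n u v i)"
  by (simp add: clinear_iff mat_vec_def scaleC_add_left sum.distrib scaleC_fun_def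
      scaleC_complex_def cvs.scale_sum_right)

lemma mat_vec_unit_vec: "k < n \<Longrightarrow> mat_vec n u (unit_vec k) i = u i k"
  by (simp add: mat_vec_def unit_vec_def of_bool_def if_distrib[of "\<lambda>c. c *\<^sub>C _"] cong: if_cong)

locale hopf_star =
  fixes \<Delta> :: "'a::star_alg \<Rightarrow> ('a \<times> 'a) list" and \<epsilon> :: "'a \<Rightarrow> complex" and S :: "'a \<Rightarrow> 'a"
  assumes hopf_star_algebra: "hopf_star_algebra \<Delta> \<epsilon> S"
begin

lemma tensor_star_hom_comult: "tensor_star_hom \<Delta>"
  and clinear_counit: "clinear \<epsilon>"
  and clinear_antipode: "clinear S"
  and antipode_left: "(\<Sum>(u, v)\<leftarrow>\<Delta> x. S u * v) = \<epsilon> x *\<^sub>C 1"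
  using hopf_star_algebra
  by (simp_all add: hopf_star_algebra_def clinear_fun_iff_clinear clinear_iff)

lemma clinear_convolution:
  fixes g h :: "'a \<Rightarrow> complex"
  assumes "clinear g" "clinear h"
  shows "clinear (\<lambda>x. \<Sum>(p, q)\<leftarrow>\<Delta> x. g p * h q)"
  using assms by (intro clinear_tensor_star_hom tensor_star_hom_comult cbilinear_mult)

lemma convolution_mat_vec:
  fixes g h :: "'a \<Rightarrow> complex"
  assumes u: "corep_matrix \<Delta> \<epsilon> n u" and gh: "clinear g" "clinear h" and "i < n"
  shows "(\<Sum>(p, q)\<leftarrow>\<Delta> (mat_vec n u v i). g p * h q) = (\<Sum>j<n. g (u i j) * h (mat_vec n u v j))"
proof -
  have entry: "(\<Sum>(p, q)\<leftarrow>\<Delta> (u i k). g p * h q) = (\<Sum>j<n. g (u i j) * h (u j k))" if "k < n" for k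
  proof -
    have "teq (\<Delta> (u i k)) (map (\<lambda>j. (u i j, u j k)) [0..<n])"
      using u \<open>i < n\<close> that by (simp add: corep_matrix_def)
    from teq_cbilinear[OF this cbilinear_mult[OF gh]] show ?thesis
      by (simp add: o_def sum_list_upt)
  qed
  have "(\<Sum>(p, q)\<leftarrow>\<Delta> (mat_vec n u v i). g p * h q) =
      (\<Sum>k<n. v k * (\<Sum>(p, q)\<leftarrow>\<Delta> (u i k). g p * h q))"
    by (simp add: mat_vec_def cvs.linear_sum[OF clinear_convolution[OF gh]]
        cvs.linear_scale[OF clinear_convolution[OF gh]] scaleC_complex_def)
  also have "\<dots> = (\<Sum>k<n. \<Sum>j<n. v k * (g (u i j) * h (u j k)))"
    by (simp add: entry sum_distrib_left)
  also have "\<dots> = (\<Sum>j<n. \<Sum>k<n. v k * (g (u i j) * h (u j k)))"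
    by (rule sum.swap)
  also have "\<dots> = (\<Sum>j<n. g (u i j) * h (mat_vec n u v j))"
    by (simp add: mat_vec_def cvs.linear_sum[OF gh(2)] cvs.linear_scale[OF gh(2)]
        scaleC_complex_def sum_distrib_left mult_ac)
  finally show ?thesis .
qed

lemma matrix_coaction_coassoc:
  assumes u: "corep_matrix \<Delta> \<epsilon> n u"
  defines "\<beta> \<equiv> matrix_coaction n u"
  shows "teq3 (concat [map (\<lambda>(w, b). (w, b, a)) (\<beta> x). (x, a) \<leftarrow> \<beta> v])
    (concat [map (\<lambda>(p, q). (x, p, q)) (\<Delta> a). (x, a) \<leftarrow> \<beta> v])"
  unfolding teq3_iff_clinear
proof (intro allI impI)
  fix f :: "(nat \<Rightarrow> complex) \<Rightarrow> complex" and g h :: "'a \<Rightarrow> complex"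
  assume lin: "clinear f" "clinear g" "clinear h"
  have "(\<Sum>(w, b, a)\<leftarrow>concat [map (\<lambda>(w, b). (w, b, a)) (\<beta> x). (x, a) \<leftarrow> \<beta> v]. f w * g b * h a)
    = (\<Sum>i<n. \<Sum>j<n. f (unit_vec j) * g (u j i) * h (mat_vec n u v i))"
    by (simp add: \<beta>_def matrix_coaction_def sum_list_concat_map o_def case_prod_unfold sum_list_upt
        mat_vec_unit_vec)
  also have "\<dots> = (\<Sum>j<n. \<Sum>i<n. f (unit_vec j) * g (u j i) * h (mat_vec n u v i))"
    by (rule sum.swap)
  also have "\<dots> = (\<Sum>j<n. f (unit_vec j) * (\<Sum>(p, q)\<leftarrow>\<Delta> (mat_vec n u v j). g p * h q))"
    by (simp add: convolution_mat_vec[OF u lin(2,3)] sum_distrib_left mult.assoc)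
  also have "\<dots> = (\<Sum>(x, p, q)\<leftarrow>concat [map (\<lambda>(p, q). (x, p, q)) (\<Delta> a). (x, a) \<leftarrow> \<beta> v].
      f x * g p * h q)"
    by (simp add: \<beta>_def matrix_coaction_def sum_list_concat_map o_def case_prod_unfold sum_list_upt
        sum_list_const_mult mult.assoc)
  finally show "(\<Sum>(w, b, a)\<leftarrow>concat [map (\<lambda>(w, b). (w, b, a)) (\<beta> x). (x, a) \<leftarrow> \<beta> v].
      f w * g b * h a) =
    (\<Sum>(x, p, q)\<leftarrow>concat [map (\<lambda>(p, q). (x, p, q)) (\<Delta> a). (x, a) \<leftarrow> \<beta> v]. f x * g p * h q)" .
qed

lemma counit_mat_vec:
  assumes "corep_matrix \<Delta> \<epsilon> n u" "i < n"
  shows "\<epsilon> (mat_vec n u v i) = v i"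
proof -
  have "\<epsilon> (mat_vec n u v i) = (\<Sum>k<n. v k * \<epsilon> (u i k))"
    by (simp add: mat_vec_def cvs.linear_sum[OF clinear_counit] cvs.linear_scale[OF clinear_counit]
        scaleC_complex_def)
  also have "\<dots> = (\<Sum>k<n. v k * of_bool (i = k))"
    using assms by (simp add: corep_matrix_def)
  finally show ?thesis using assms(2) by simp
qed

lemma right_comodule_matrix_coaction:
  assumes u: "corep_matrix \<Delta> \<epsilon> n u"
  shows "right_comodule \<Delta> \<epsilon> n (matrix_coaction n u)"
  unfolding right_comodule_def
proof (intro conjI ballI allI)
  fix v w c
  show "fst ` set (matrix_coaction n u v) \<subseteq> cspace n"
    by (auto simp: matrix_coaction_def)
  show "teq (matrix_coaction n u (v + w)) (matrix_coaction n u v @ matrix_coaction n u w)"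
    by (simp add: teq_iff_clinear matrix_coaction_def o_def sum_list_upt
        cvs.linear_add[OF clinear_mat_vec] cvs.linear_add distrib_left sum.distrib)
  show "teq (matrix_coaction n u (c *\<^sub>C v)) (map (\<lambda>(w, a). (c *\<^sub>C w, a)) (matrix_coaction n u v))"
    by (simp add: teq_iff_clinear matrix_coaction_def o_def sum_list_upt
        cvs.linear_scale[OF clinear_mat_vec] cvs.linear_scale scaleC_complex_def mult_ac)
  show "teq3
    (concat [map (\<lambda>(w, b). (w, b, a)) (matrix_coaction n u x). (x, a) \<leftarrow> matrix_coaction n u v])
    (concat [map (\<lambda>(p, q). (x, p, q)) (\<Delta> a). (x, a) \<leftarrow> matrix_coaction n u v])"
    by (rule matrix_coaction_coassoc[OF u])
next
  fix v assume "v \<in> cspace n"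
  then show "(\<Sum>(w, a)\<leftarrow>matrix_coaction n u v. \<epsilon> a *\<^sub>C w) = v"
    by (simp add: matrix_coaction_def o_def sum_list_upt counit_mat_vec[OF u] sum_unit_vec)
qed

end

lemma
  assumes "invariant_scalar_product n \<alpha> \<phi>" "v \<in> cspace n" "w \<in> cspace n"
  shows invariant_scalar_product_herm: "\<phi> w v = cnj (\<phi> v w)"
    and invariant_scalar_product_scale: "\<phi> v (c *\<^sub>C w) = c * \<phi> v w"
    and invariant_scalar_product_add: "x \<in> cspace n \<Longrightarrow> \<phi> v (w + x) = \<phi> v w + \<phi> v x"
    and invariant_scalar_product_invariant:
      "(\<Sum>(v', a)\<leftarrow>\<alpha> v. \<Sum>(w', b)\<leftarrow>\<alpha> w. \<phi> v' w' *\<^sub>C (star a * b)) = \<phi> v w *\<^sub>C 1"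
  using assms unfolding invariant_scalar_product_def by blast+

lemma invariant_scalar_product_sum:
  assumes \<phi>: "invariant_scalar_product n \<alpha> \<phi>" and v: "v \<in> cspace n" and "m \<le> n"
  shows "\<phi> v (\<Sum>i<m. x i *\<^sub>C unit_vec i) = (\<Sum>i<m. x i * \<phi> v (unit_vec i))"
  using \<open>m \<le> n\<close>
proof (induction m)
  case 0
  have "\<phi> v (0 *\<^sub>C 0) = 0 * \<phi> v 0"
    by (intro invariant_scalar_product_scale[OF \<phi> v] cvs.subspace_0[OF subspace_cspace])
  then show ?case by (simp only: cvs.scale_zero_left mult_zero_left lessThan_0 sum.empty)
next
  case (Suc m)
  then have unit: "unit_vec i \<in> cspace n" if "i \<le> m" for i using that by simp
  then have "x m *\<^sub>C unit_vec m \<in> cspace n" "(\<Sum>i<m. x i *\<^sub>C unit_vec i) \<in> cspace n"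
    by (auto intro!: cvs.subspace_sum[OF subspace_cspace] cvs.subspace_scale[OF subspace_cspace])
  then have "\<phi> v (\<Sum>i<Suc m. x i *\<^sub>C unit_vec i) =
      \<phi> v (\<Sum>i<m. x i *\<^sub>C unit_vec i) + x m * \<phi> v (unit_vec m)"
    unfolding sum.lessThan_Suc
    by (simp only: invariant_scalar_product_add[OF \<phi> v]
        invariant_scalar_product_scale[OF \<phi> v unit[OF order_refl]])
  with Suc show ?case by (simp only: sum.lessThan_Suc Suc_leD)
qed

lemma posdef_invariant_scalar_product:
  assumes \<phi>: "invariant_scalar_product n \<alpha> \<phi>"
  defines "F \<equiv> \<lambda>i j. \<phi> (unit_vec i) (unit_vec j)"
  shows "posdef n F"
  unfolding posdef_def
proof (intro conjI allI impI)
  show F_herm: "F j i = cnj (F i j)" if "i < n" "j < n" for i j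
    unfolding F_def using that by (intro invariant_scalar_product_herm[OF \<phi>]) simp_all
  fix x :: "nat \<Rightarrow> complex" assume "\<exists>i<n. x i \<noteq> 0"
  define X where "X i = (if i < n then x i else 0)" for i
  have X: "X \<in> cspace n" by (simp add: X_def cspace_def)
  have expand: "\<phi> v X = (\<Sum>j<n. X j * \<phi> v (unit_vec j))" if "v \<in> cspace n" for v
    using invariant_scalar_product_sum[OF \<phi> that order_refl, of X]
    by (simp only: sum_unit_vec[OF X])
  have "X \<noteq> 0" using \<open>\<exists>i<n. x i \<noteq> 0\<close> by (auto simp: X_def fun_eq_iff)
  then have "Re (\<phi> X X) > 0" using \<phi> X unfolding invariant_scalar_product_def by blast
  also have "\<phi> X X = (\<Sum>j<n. X j * cnj (\<Sum>i<n. X i * F j i))"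
    unfolding expand[OF X]
  proof (intro sum.cong refl arg_cong2[of _ _ _ _ "(*)"])
    fix j assume "j \<in> {..<n}"
    then have unit: "unit_vec j \<in> cspace n" by simp
    show "\<phi> X (unit_vec j) = cnj (\<Sum>i<n. X i * F j i)"
      unfolding F_def expand[OF unit, symmetric]
      by (rule invariant_scalar_product_herm[OF \<phi> unit X])
  qed
  also have "\<dots> = (\<Sum>j<n. \<Sum>i<n. X j * (cnj (X i) * F i j))"
    by (simp add: sum_distrib_left flip: F_herm)
  also have "\<dots> = herm_form n F X"
    unfolding herm_form_def
    by (subst sum.swap) (simp add: star_complex_def scaleC_complex_def mult_ac)
  also have "\<dots> = herm_form n F x" by (rule herm_form_cong) (simp add: X_def)
  finally show "Re (herm_form n F x) > 0" .
qed

lemma (in hopf_star) corep_matrix_invariant_form: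
  assumes u: "corep_matrix \<Delta> \<epsilon> n u" and "unitarizable \<Delta> \<epsilon>"
  obtains F where "posdef n F"
    "\<And>k l. k < n \<Longrightarrow> l < n \<Longrightarrow> (\<Sum>i<n. \<Sum>j<n. F i j *\<^sub>C (star (u i k) * u j l)) = F k l *\<^sub>C 1"
proof -
  obtain \<phi> where \<phi>: "invariant_scalar_product n (matrix_coaction n u) \<phi>"
    using assms right_comodule_matrix_coaction unfolding unitarizable_def by blast
  show ?thesis
  proof (rule that[OF posdef_invariant_scalar_product[OF \<phi>]])
    fix k l assume "k < n" "l < n"
    then have "(\<Sum>(v', a)\<leftarrow>matrix_coaction n u (unit_vec k).
      \<Sum>(w', b)\<leftarrow>matrix_coaction n u (unit_vec l).
        \<phi> v' w' *\<^sub>C (star a * b)) = \<phi> (unit_vec k) (unit_vec l) *\<^sub>C 1"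
      by (intro invariant_scalar_product_invariant[OF \<phi>]) simp_all
    with \<open>k < n\<close> \<open>l < n\<close> show "(\<Sum>i<n. \<Sum>j<n. \<phi> (unit_vec i) (unit_vec j) *\<^sub>C (star (u i k) * u j l)) =
        \<phi> (unit_vec k) (unit_vec l) *\<^sub>C 1"
      by (simp add: matrix_coaction_def o_def sum_list_upt mat_vec_unit_vec)
  qed
qed

section \<open>Finite-dimensional subcomodules of a comodule algebra\<close>

locale star_comodule_algebra = hopf_star \<Delta> \<epsilon> S
  for \<Delta> :: "'a::star_alg \<Rightarrow> ('a \<times> 'a) list" and \<epsilon> :: "'a \<Rightarrow> complex" and S :: "'a \<Rightarrow> 'a" +
  fixes \<alpha> :: "'z::star_alg \<Rightarrow> ('a \<times> 'z) list"
  assumes left_coaction: "left_coaction \<Delta> \<epsilon> \<alpha>" and tensor_star_hom_coaction: "tensor_star_hom \<alpha>"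
begin

lemma coaction_counit: "(\<Sum>(a, y)\<leftarrow>\<alpha> z. \<epsilon> a *\<^sub>C y) = z"
  using left_coaction by (simp add: left_coaction_def)

lemma coaction_coassoc:
  assumes "ctrilinear B"
  shows "(\<Sum>(a, y)\<leftarrow>\<alpha> z. \<Sum>(p, q)\<leftarrow>\<Delta> a. B p q y) = (\<Sum>(a, y)\<leftarrow>\<alpha> z. \<Sum>(b, x)\<leftarrow>\<alpha> y. B a b x)"
proof -
  have "teq3 (concat [map (\<lambda>(p, q). (p, q, y)) (\<Delta> a). (a, y) \<leftarrow> \<alpha> z])
                (concat [map (\<lambda>(b, x). (a, b, x)) (\<alpha> y). (a, y) \<leftarrow> \<alpha> z])"
    using left_coaction by (simp add: left_coaction_def)
  from teq3_ctrilinear[OF this assms] show ?thesis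
    by (simp add: sum_list_concat_map case_prod_unfold o_def)
qed

definition slice :: "('a \<Rightarrow> complex) \<Rightarrow> 'z \<Rightarrow> 'z" where
  "slice g z = (\<Sum>(a, y)\<leftarrow>\<alpha> z. g a *\<^sub>C y)"

lemma clinear_slice: "clinear g \<Longrightarrow> clinear (slice g)"
  unfolding slice_def
  by (intro clinear_tensor_star_hom tensor_star_hom_coaction cbilinear_scaleC cvs.linear_ident)

lemma clinear_apply_slice:
  fixes h :: "'z \<Rightarrow> complex"
  assumes "clinear h"
  shows "h (slice g z) = (\<Sum>(a, y)\<leftarrow>\<alpha> z. g a * h y)"
  by (simp add: slice_def clinear_sum_list[OF assms] case_prod_unfold cvs.linear_scale[OF assms]
      scaleC_complex_def)

lemma slice_slice:
  assumes "clinear g" "clinear h"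
  shows "slice h (slice g z) = slice (\<lambda>c. \<Sum>(p, q)\<leftarrow>\<Delta> c. g p * h q) z"
proof -
  have "ctrilinear (\<lambda>p q y. (g p * h q) *\<^sub>C (y :: 'z))"
    using assms
    by (intro ctrilinearI cbilinear_scaleC clinear_scaleC_left clinear_mult_left clinear_mult_right
        cvs.linear_ident)
  from coaction_coassoc[OF this] show ?thesis
    by (simp add: slice_def[of g] clinear_sum_list[OF clinear_slice[OF assms(2)]] case_prod_unfold
        cvs.linear_scale[OF clinear_slice[OF assms(2)]])
      (simp add: slice_def case_prod_unfold scaleC_sum_list sum_list_scaleC)
qed

definition slices :: "'z \<Rightarrow> 'z set" where
  "slices z = {slice g z |g. clinear g}"

lemma slicesI: "clinear g \<Longrightarrow> slice g z \<in> slices z"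
  by (auto simp: slices_def)

lemma mem_slices_self: "z \<in> slices z"
  using slicesI[OF clinear_counit, of z] by (simp add: slice_def coaction_counit)

lemma slice_in_slices: "clinear g \<Longrightarrow> v \<in> slices z \<Longrightarrow> slice g v \<in> slices z"
  by (auto simp: slices_def slice_slice intro: clinear_convolution)

lemma slices_subset_span: "slices z \<subseteq> cvs.span (snd ` set (\<alpha> z))"
proof
  fix v assume "v \<in> slices z"
  then obtain g where "v = slice g z" by (auto simp: slices_def)
  moreover have "(\<Sum>(a, y)\<leftarrow>xs. g a *\<^sub>C y) \<in> cvs.span (snd ` set xs)" for xs
  proof (induction xs)
    case (Cons x xs)
    then show ?case
      by (auto simp: case_prod_unfold intro!: cvs.span_add cvs.span_scale
          intro: cvs.span_base cvs.span_mono[THEN subsetD, of "snd ` set xs"])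
  qed (simp add: cvs.span_zero)
  ultimately show "v \<in> cvs.span (snd ` set (\<alpha> z))" by (simp add: slice_def)
qed

lemma slices_dual_basis:
  obtains n and e :: "nat \<Rightarrow> 'z" and f :: "nat \<Rightarrow> 'z \<Rightarrow> complex" where
    "\<And>i. i < n \<Longrightarrow> e i \<in> slices z" "\<And>j. clinear (f j)"
    "\<And>i j. i < n \<Longrightarrow> j < n \<Longrightarrow> f j (e i) = of_bool (i = j)"
    "\<And>v. v \<in> slices z \<Longrightarrow> (\<Sum>j<n. f j v *\<^sub>C e j) = v"
proof -
  obtain B where B: "B \<subseteq> slices z" "cvs.independent B" "slices z \<subseteq> cvs.span B"
    by (rule cvs.maximal_independent_subset)
  then have "finite B"
    using slices_subset_span cvs.independent_span_bound[of "snd ` set (\<alpha> z)" B] by blast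
  with B(2) obtain f where f: "\<And>b. clinear (f b :: 'z \<Rightarrow> complex)"
    "\<And>b c. b \<in> B \<Longrightarrow> c \<in> B \<Longrightarrow> f b c = of_bool (b = c)"
    "\<And>v. v \<in> cvs.span B \<Longrightarrow> (\<Sum>b\<in>B. f b v *\<^sub>C b) = v"
    by (rule coordinate_functionals) blast
  obtain n and e :: "nat \<Rightarrow> 'z" where e: "B = e ` {..<n}" "inj_on e {..<n}"
    using finite_imp_nat_seg_image_inj_on[OF \<open>finite B\<close>] by (auto simp: lessThan_def)
  show ?thesis
  proof (rule that[of n e "\<lambda>j. f (e j)"])
    show "f (e j) (e i) = of_bool (i = j)" if "i < n" "j < n" for i j
      using f(2)[of "e j" "e i"] e that by (auto simp: inj_on_def)
    show "(\<Sum>j<n. f (e j) v *\<^sub>C e j) = v" if "v \<in> slices z" for v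
      using f(3)[of v] B(3) that unfolding e(1) sum.reindex[OF e(2)] by auto
  qed (use B(1) e(1) f(1) in auto)
qed

definition coaction_coeff :: "('z \<Rightarrow> complex) \<Rightarrow> 'z \<Rightarrow> 'a" where
  "coaction_coeff f z = (\<Sum>(a, y)\<leftarrow>\<alpha> z. f y *\<^sub>C a)"

lemma clinear_apply_coaction_coeff:
  fixes g :: "'a \<Rightarrow> complex"
  assumes "clinear g" "clinear f"
  shows "g (coaction_coeff f z) = f (slice g z)"
  by (simp add: coaction_coeff_def clinear_apply_slice[OF assms(2)] clinear_sum_list[OF assms(1)]
      case_prod_unfold cvs.linear_scale[OF assms(1)] scaleC_complex_def mult.commute)

lemma convolution_coaction_coeff:
  fixes g h :: "'a \<Rightarrow> complex"
  assumes "clinear g" "clinear h" "clinear f"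
  shows "(\<Sum>(p, q)\<leftarrow>\<Delta> (coaction_coeff f z). g p * h q) = f (slice h (slice g z))"
  unfolding slice_slice[OF assms(1,2)]
  by (rule clinear_apply_coaction_coeff[OF clinear_convolution[OF assms(1,2)] assms(3)])

lemma coaction_basis:
  assumes f: "\<And>j. clinear (f j)" "\<And>v. v \<in> slices z \<Longrightarrow> (\<Sum>j<n. f j v *\<^sub>C e j) = v"
    and "v \<in> slices z"
  shows "teq (\<alpha> v) (map (\<lambda>j. (coaction_coeff (f j) v, e j)) [0..<n])"
  unfolding teq_iff_clinear
proof (intro allI impI)
  fix g :: "'a \<Rightarrow> complex" and h :: "'z \<Rightarrow> complex" assume g: "clinear g" and h: "clinear h"
  have "(\<Sum>(a, y)\<leftarrow>\<alpha> v. g a * h y) = h (slice g v)"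
    by (rule clinear_apply_slice[OF h, symmetric])
  also have "\<dots> = h (\<Sum>j<n. f j (slice g v) *\<^sub>C e j)"
    by (simp add: f(2) slice_in_slices g assms(3))
  also have "\<dots> = (\<Sum>j<n. g (coaction_coeff (f j) v) * h (e j))"
    by (simp add: cvs.linear_sum[OF h] cvs.linear_scale[OF h] scaleC_complex_def
        clinear_apply_coaction_coeff[OF g f(1)])
  finally show "(\<Sum>(a, y)\<leftarrow>\<alpha> v. g a * h y) =
      (\<Sum>(a, y)\<leftarrow>map (\<lambda>j. (coaction_coeff (f j) v, e j)) [0..<n]. g a * h y)"
    by (simp add: o_def sum_list_upt)
qed

lemma corep_matrix_coaction_coeff:
  assumes f: "\<And>j. clinear (f j)" "\<And>v. v \<in> slices z \<Longrightarrow> (\<Sum>j<n. f j v *\<^sub>C e j) = v"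
    and e: "\<And>i. i < n \<Longrightarrow> e i \<in> slices z"
      "\<And>i j. i < n \<Longrightarrow> j < n \<Longrightarrow> f j (e i) = of_bool (i = j)"
  shows "corep_matrix \<Delta> \<epsilon> n (\<lambda>i j. coaction_coeff (f j) (e i))"
  unfolding corep_matrix_def
proof (intro allI impI conjI)
  fix i j assume ij: "i < n" "j < n"
  have "\<epsilon> (coaction_coeff (f j) (e i)) = f j (e i)"
    by (simp add: clinear_apply_coaction_coeff[OF clinear_counit f(1)])
      (simp add: slice_def coaction_counit)
  then show "\<epsilon> (coaction_coeff (f j) (e i)) = of_bool (i = j)" using e(2) ij by simp
  show "teq (\<Delta> (coaction_coeff (f j) (e i)))
      (map (\<lambda>k. (coaction_coeff (f k) (e i), coaction_coeff (f j) (e k))) [0..<n])"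
    unfolding teq_iff_clinear
  proof (intro allI impI)
    fix g h :: "'a \<Rightarrow> complex" assume g: "clinear g" and h: "clinear h"
    have lin: "clinear (\<lambda>v. f j (slice h v))"
      by (rule clinear_compose[OF f(1) clinear_slice[OF h]])
    have "(\<Sum>(p, q)\<leftarrow>\<Delta> (coaction_coeff (f j) (e i)). g p * h q) = f j (slice h (slice g (e i)))"
      by (rule convolution_coaction_coeff[OF g h f(1)])
    also have "\<dots> = f j (slice h (\<Sum>k<n. f k (slice g (e i)) *\<^sub>C e k))"
      by (simp add: f(2) slice_in_slices g e(1) ij)
    also have "\<dots> = (\<Sum>k<n. f k (slice g (e i)) * f j (slice h (e k)))"
      by (simp add: cvs.linear_sum[OF lin] cvs.linear_scale[OF lin] scaleC_complex_def)
    finally show "(\<Sum>(p, q)\<leftarrow>\<Delta> (coaction_coeff (f j) (e i)). g p * h q) =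
        (\<Sum>(p, q)\<leftarrow>map (\<lambda>k. (coaction_coeff (f k) (e i), coaction_coeff (f j) (e k))) [0..<n].
          g p * h q)"
      by (simp add: o_def sum_list_upt clinear_apply_coaction_coeff[OF g f(1)]
          clinear_apply_coaction_coeff[OF h f(1)])
  qed
qed

lemma subcomodule_basis:
  obtains n and e :: "nat \<Rightarrow> 'z" and u :: "nat \<Rightarrow> nat \<Rightarrow> 'a" where
    "z \<in> cvs.span (e ` {..<n})" "corep_matrix \<Delta> \<epsilon> n u"
    "\<And>i. i < n \<Longrightarrow> teq (\<alpha> (e i)) (map (\<lambda>j. (u i j, e j)) [0..<n])"
proof -
  obtain n and e :: "nat \<Rightarrow> 'z" and f :: "nat \<Rightarrow> 'z \<Rightarrow> complex"
    where e: "\<And>i. i < n \<Longrightarrow> e i \<in> slices z" and f: "\<And>j. clinear (f j)"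
    and dual: "\<And>i j. i < n \<Longrightarrow> j < n \<Longrightarrow> f j (e i) = of_bool (i = j)"
    and expand: "\<And>v. v \<in> slices z \<Longrightarrow> (\<Sum>j<n. f j v *\<^sub>C e j) = v"
    by (rule slices_dual_basis) blast
  show ?thesis
  proof (rule that)
    have "(\<Sum>j<n. f j z *\<^sub>C e j) \<in> cvs.span (e ` {..<n})"
      by (intro cvs.span_sum cvs.span_scale cvs.span_base) auto
    then show "z \<in> cvs.span (e ` {..<n})" by (simp add: expand mem_slices_self)
    show "corep_matrix \<Delta> \<epsilon> n (\<lambda>i j. coaction_coeff (f j) (e i))"
      using f expand e dual by (rule corep_matrix_coaction_coeff)
    show "teq (\<alpha> (e i)) (map (\<lambda>j. (coaction_coeff (f j) (e i), e j)) [0..<n])" if "i < n" for i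
      using f expand e[OF that] by (rule coaction_basis)
  qed
qed

lemma coaction_star_mult_basis:
  fixes B :: "'a \<Rightarrow> 'z \<Rightarrow> complex"
  assumes e: "\<And>i. i < n \<Longrightarrow> teq (\<alpha> (e i)) (map (\<lambda>j. (u i j, e j)) [0..<n])"
    and B: "cbilinear B" and ij: "i < n" "j < n"
  shows "(\<Sum>(a, y)\<leftarrow>\<alpha> (star (e i) * e j). B a y) =
    (\<Sum>k<n. \<Sum>l<n. B (star (u i k) * u j l) (star (e k) * e l))"
proof -
  have "teq (\<alpha> (star (e i))) (map (\<lambda>(a, b). (star a, star b)) (\<alpha> (e i)))"
    using tensor_star_hom_coaction by (simp add: tensor_star_hom_def)
  also have "teq \<dots> (map (\<lambda>(a, b). (star a, star b)) (map (\<lambda>j. (u i j, e j)) [0..<n]))"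
    by (intro teq_map_star e ij)
  finally have star: "teq (\<alpha> (star (e i))) (map (\<lambda>k. (star (u i k), star (e k))) [0..<n])"
    by (simp add: o_def)
  have right: "cbilinear (\<lambda>a' y'. B (a * a') (y * y'))" for a y
    by (intro cbilinear_compose[OF B] clinear_mult_left cvs.linear_ident)
  have left: "cbilinear (\<lambda>a y. \<Sum>l<n. B (a * u j l) (y * e l))"
    by (intro cbilinear_sum cbilinear_compose[OF B] clinear_mult_right cvs.linear_ident)
  have "(\<Sum>(a, y)\<leftarrow>\<alpha> (star (e i) * e j). B a y) =
      (\<Sum>(a, y)\<leftarrow>\<alpha> (star (e i)). \<Sum>(a', y')\<leftarrow>\<alpha> (e j). B (a * a') (y * y'))"
    by (rule tensor_star_hom_mult[OF tensor_star_hom_coaction B])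
  also have "\<dots> = (\<Sum>(a, y)\<leftarrow>\<alpha> (star (e i)). \<Sum>l<n. B (a * u j l) (y * e l))"
    by (simp add: teq_cbilinear[OF e[OF ij(2)] right] o_def sum_list_upt)
  also have "\<dots> = (\<Sum>k<n. \<Sum>l<n. B (star (u i k) * u j l) (star (e k) * e l))"
    by (simp add: teq_cbilinear[OF star left] o_def sum_list_upt)
  finally show ?thesis .
qed

lemma coinvariant_herm_form:
  assumes e: "\<And>i. i < n \<Longrightarrow> teq (\<alpha> (e i)) (map (\<lambda>j. (u i j, e j)) [0..<n])"
    and F: "\<And>k l. k < n \<Longrightarrow> l < n \<Longrightarrow>
      (\<Sum>i<n. \<Sum>j<n. F i j *\<^sub>C (star (u i k) * u j l)) = F k l *\<^sub>C 1"
  shows "teq (\<alpha> (herm_form n F e)) [(1, herm_form n F e)]"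
proof (rule teqI)
  fix B :: "'a \<Rightarrow> 'z \<Rightarrow> complex" assume B: "cbilinear B"
  note right = cbilinear_right[OF B] and left = cbilinear_left[OF B]
  define L where "L x = (\<Sum>(a, y)\<leftarrow>\<alpha> x. B a y)" for x
  have L: "clinear L"
    unfolding L_def by (intro clinear_tensor_star_hom tensor_star_hom_coaction B)
  have "L (herm_form n F e) = (\<Sum>i<n. \<Sum>j<n. F i j * L (star (e i) * e j))"
    by (simp add: herm_form_def cvs.linear_sum[OF L] cvs.linear_scale[OF L] scaleC_complex_def)
  also have "\<dots> = (\<Sum>i<n. \<Sum>j<n. \<Sum>k<n. \<Sum>l<n. F i j * B (star (u i k) * u j l) (star (e k) * e l))"
    by (simp add: L_def coaction_star_mult_basis[OF e B] sum_distrib_left)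
  also have "\<dots> = (\<Sum>k<n. \<Sum>l<n. \<Sum>i<n. \<Sum>j<n. F i j * B (star (u i k) * u j l) (star (e k) * e l))"
    by (rule sum_swap_pairs)
  also have "\<dots> = (\<Sum>k<n. \<Sum>l<n. B (\<Sum>i<n. \<Sum>j<n. F i j *\<^sub>C (star (u i k) * u j l)) (star (e k) * e l))"
    by (simp add: cvs.linear_sum[OF left] cvs.linear_scale[OF left] scaleC_complex_def)
  also have "\<dots> = B 1 (herm_form n F e)"
    by (simp add: F cvs.linear_scale[OF left] herm_form_def cvs.linear_sum[OF right]
        cvs.linear_scale[OF right])
  finally show "(\<Sum>(a, y)\<leftarrow>\<alpha> (herm_form n F e). B a y) = (\<Sum>(a, y)\<leftarrow>[(1, herm_form n F e)]. B a y)"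
    by (simp add: L_def)
qed

lemma strong_invariance:
  assumes "haar_measure \<alpha> \<mu>"
  shows "(\<Sum>(a, w)\<leftarrow>\<alpha> z. \<mu> (y * w) *\<^sub>C a) = (\<Sum>(b, v)\<leftarrow>\<alpha> y. \<mu> (v * z) *\<^sub>C S b)"
proof -
  have \<mu>: "clinear \<mu>" and invariant: "(\<Sum>(a, y)\<leftarrow>\<alpha> x. \<mu> y *\<^sub>C a) = \<mu> x *\<^sub>C 1" for x
    using assms by (simp_all add: haar_measure_def clinear_fun_iff_clinear)
  define T where "T v = (\<Sum>(a, w)\<leftarrow>\<alpha> z. \<mu> (v * w) *\<^sub>C a)" for v
  have T: "clinear T"
    unfolding T_def case_prod_unfold
    by (intro clinear_sum_list_fun clinear_scaleC_left clinear_compose[OF \<mu>] clinear_mult_right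
        cvs.linear_ident)
  have tri: "ctrilinear (\<lambda>b b' v. S b * b' * T v)"
    by (intro ctrilinearI cbilinear_mult clinear_mult_left clinear_mult_right clinear_antipode
        cvs.linear_ident T)
  have flip: "cbilinear (\<lambda>a y. \<mu> y *\<^sub>C a)"
    by (rule cbilinear_flip[OF cbilinear_scaleC[OF \<mu> cvs.linear_ident]])
  have "(\<Sum>(b, v)\<leftarrow>\<alpha> y. \<mu> (v * z) *\<^sub>C S b) = (\<Sum>(b, v)\<leftarrow>\<alpha> y. S b * (\<Sum>(a, w)\<leftarrow>\<alpha> (v * z). \<mu> w *\<^sub>C a))"
    by (simp add: invariant mult_scaleC_right)
  also have "\<dots> = (\<Sum>(b, v)\<leftarrow>\<alpha> y.
      S b * (\<Sum>(b', v')\<leftarrow>\<alpha> v. \<Sum>(a, w)\<leftarrow>\<alpha> z. \<mu> (v' * w) *\<^sub>C (b' * a)))"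
    by (simp add: tensor_star_hom_mult[OF tensor_star_hom_coaction flip])
  also have "\<dots> = (\<Sum>(b, v)\<leftarrow>\<alpha> y. \<Sum>(b', v')\<leftarrow>\<alpha> v. S b * b' * T v')"
    by (simp add: T_def case_prod_unfold sum_list_const_mult[symmetric] mult_scaleC_right
        mult.assoc)
  also have "\<dots> = (\<Sum>(b, v)\<leftarrow>\<alpha> y. (\<Sum>(p, q)\<leftarrow>\<Delta> b. S p * q) * T v)"
    using coaction_coassoc[OF tri, symmetric] by (simp add: case_prod_unfold sum_list_mult_const)
  also have "\<dots> = (\<Sum>(b, v)\<leftarrow>\<alpha> y. \<epsilon> b *\<^sub>C T v)"
    by (simp add: antipode_left mult_scaleC_left)
  also have "\<dots> = T (\<Sum>(b, v)\<leftarrow>\<alpha> y. \<epsilon> b *\<^sub>C v)"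
    by (simp add: clinear_sum_list[OF T] case_prod_unfold cvs.linear_scale[OF T])
  finally show ?thesis by (simp add: coaction_counit T_def)
qed

end

section \<open>Galois extensions\<close>

locale star_galois = hopf_star \<Delta> \<epsilon> S
  for \<Delta> :: "'a::star_alg \<Rightarrow> ('a \<times> 'a) list" and \<epsilon> :: "'a \<Rightarrow> complex" and S :: "'a \<Rightarrow> 'a" +
  fixes \<alpha> :: "'z::star_alg \<Rightarrow> ('a \<times> 'z) list"
  assumes star_galois_extension: "star_galois_extension \<Delta> \<epsilon> \<alpha>"

sublocale star_galois \<subseteq> star_comodule_algebra
  using star_galois_extension by unfold_locales (simp_all add: star_galois_extension_def)

context star_galois
begin

lemma galois_map_surj: "\<exists>s. teq (galois_map \<alpha> s) t"
  and galois_map_inj: "teq (galois_map \<alpha> s) (galois_map \<alpha> s') \<Longrightarrow> teq s s'"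
  using star_galois_extension by (simp_all add: star_galois_extension_def)

lemma coinvariant_imp_scalar:
  assumes w: "teq (\<alpha> w) [(1, w)]" and \<mu>: "clinear \<mu>" "\<mu> 1 = 1"
  shows "w = \<mu> w *\<^sub>C 1"
proof -
  have one: "teq (\<alpha> 1) [(1, 1)]"
    using tensor_star_hom_coaction by (simp add: tensor_star_hom_def)
  have "teq (galois_map \<alpha> [(1, w)]) [(1, w)]"
  proof (rule teqI)
    fix B :: "'a \<Rightarrow> 'z \<Rightarrow> complex" assume "cbilinear B"
    then have "cbilinear (\<lambda>a y. B a (y * w))"
      by (rule cbilinear_compose[OF _ cvs.linear_ident clinear_mult_right[OF cvs.linear_ident]])
    from teq_cbilinear[OF one this]
    show "(\<Sum>(a, y)\<leftarrow>galois_map \<alpha> [(1, w)]. B a y) = (\<Sum>(a, y)\<leftarrow>[(1, w)]. B a y)"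
      by (simp add: galois_map_def o_def case_prod_unfold)
  qed
  moreover have "teq (galois_map \<alpha> [(w, 1)]) [(1, w)]"
    using w by (simp add: galois_map_def)
  ultimately have "teq [(w, 1)] [(1, w)]"
    by (intro galois_map_inj) (rule teq_trans[OF _ teq_sym])
  from teq_cbilinear[OF this cbilinear_flip[OF cbilinear_scaleC[OF \<mu>(1) cvs.linear_ident]]]
  show ?thesis by (simp add: \<mu>(2))
qed

lemma galois_map_right_mult:
  assumes "teq (galois_map \<alpha> s) [(a, 1)]"
  shows "teq (galois_map \<alpha> (map (\<lambda>(p, q). (p, q * w)) s)) [(a, w)]"
proof (rule teqI)
  fix B :: "'a \<Rightarrow> 'z \<Rightarrow> complex" assume "cbilinear B"
  then have "cbilinear (\<lambda>a y. B a (y * w))"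
    by (rule cbilinear_compose[OF _ cvs.linear_ident clinear_mult_right[OF cvs.linear_ident]])
  from teq_cbilinear[OF assms this]
  show "(\<Sum>(a, y)\<leftarrow>galois_map \<alpha> (map (\<lambda>(p, q). (p, q * w)) s). B a y) = (\<Sum>(a, y)\<leftarrow>[(a, w)]. B a y)"
    by (simp add: galois_map_def sum_list_concat_map o_def case_prod_unfold mult.assoc)
qed

lemma tensor_one_in_slices_ideal:
  obtains s where "teq [(z, 1)] s"
    "\<And>p w. (p, w) \<in> set s \<Longrightarrow> \<exists>y f. clinear f \<and> w = y * slice f z"
proof -
  obtain es f where f: "\<And>e. clinear (f e :: 'a \<Rightarrow> complex)"
    "teq (\<alpha> z) (map (\<lambda>e. (e, slice (f e) z)) es)"
    using teq_expansion[of "\<alpha> z"] unfolding slice_def by blast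
  have "\<forall>a. \<exists>s. teq (galois_map \<alpha> s) [(a, 1)]" using galois_map_surj by blast
  then obtain \<kappa> where \<kappa>: "\<And>a. teq (galois_map \<alpha> (\<kappa> a)) [(a, 1)]" by metis
  define t where "t e = map (\<lambda>(p, q). (p, q * slice (f e) z)) (\<kappa> e)" for e
  have t: "teq (galois_map \<alpha> (t e)) [(e, slice (f e) z)]" for e
    unfolding t_def by (rule galois_map_right_mult[OF \<kappa>])
  have "teq (galois_map \<alpha> (concat (map t es))) (map (\<lambda>e. (e, slice (f e) z)) es)"
  proof (rule teqI)
    fix B :: "'a \<Rightarrow> 'z \<Rightarrow> complex" assume "cbilinear B"
    from teq_cbilinear[OF t this]
    show "(\<Sum>(a, y)\<leftarrow>galois_map \<alpha> (concat (map t es)). B a y) =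
        (\<Sum>(a, y)\<leftarrow>map (\<lambda>e. (e, slice (f e) z)) es. B a y)"
      by (simp add: galois_map_def sum_list_concat_map o_def case_prod_unfold)
  qed
  moreover have "teq (galois_map \<alpha> [(z, 1)]) (map (\<lambda>e. (e, slice (f e) z)) es)"
    using f(2) by (simp add: galois_map_def)
  ultimately have "teq [(z, 1)] (concat (map t es))"
    by (intro galois_map_inj) (rule teq_trans[OF _ teq_sym])
  then show ?thesis by (rule that) (use f(1) in \<open>auto simp: t_def\<close>)
qed

end

locale star_galois_haar = star_galois \<Delta> \<epsilon> S \<alpha>
  for \<Delta> :: "'a::star_alg \<Rightarrow> ('a \<times> 'a) list" and \<epsilon> :: "'a \<Rightarrow> complex" and S :: "'a \<Rightarrow> 'a"
    and \<alpha> :: "'z::star_alg \<Rightarrow> ('a \<times> 'z) list" +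
  fixes \<mu> :: "'z \<Rightarrow> complex"
  assumes haar: "haar_measure \<alpha> \<mu>" and mu_positive: "positive_functional \<mu>"

sublocale star_galois_haar \<subseteq> positive_form \<mu>
  using haar mu_positive
  by (intro positive_form.intro) (simp_all add: haar_measure_def clinear_fun_iff_clinear)

context star_galois_haar
begin

lemma mu_one: "\<mu> 1 = 1"
  using haar by (simp add: haar_measure_def)

lemma null_vector_slice:
  assumes "gns_norm z = 0" "clinear f"
  shows "\<mu> (y * slice f z) = 0"
proof -
  have null: "\<mu> (v * z) = 0" for v
    using Cauchy_Schwarz[of "star v" z] assms(1) by (simp add: star_star)
  have "\<mu> (y * slice f z) = f (\<Sum>(a, w)\<leftarrow>\<alpha> z. \<mu> (y * w) *\<^sub>C a)"
    by (simp add: clinear_sum_list[OF assms(2)] case_prod_unfold cvs.linear_scale[OF assms(2)]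
        clinear_apply_slice[OF clinear_compose[OF clinear clinear_mult_left[OF cvs.linear_ident]]]
        scaleC_complex_def mult.commute)
  then show ?thesis
    unfolding strong_invariance[OF haar]
    by (simp add: null case_prod_unfold cvs.linear_0[OF assms(2)])
qed

lemma gns_norm_eq_0_imp_eq_0:
  assumes "gns_norm z = 0"
  shows "z = 0"
proof -
  obtain s where s: "teq [(z, 1)] s"
    "\<And>p w. (p, w) \<in> set s \<Longrightarrow> \<exists>y f. clinear f \<and> w = y * slice f z"
    by (rule tensor_one_in_slices_ideal) blast
  have "z = (\<Sum>(p, w)\<leftarrow>s. \<mu> w *\<^sub>C p)"
    using teq_cbilinear[OF s(1) cbilinear_flip[OF cbilinear_scaleC[OF clinear cvs.linear_ident]]]
    by (simp add: mu_one)
  also have "\<dots> = (\<Sum>(p, w)\<leftarrow>s. 0)"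
    using s(2) null_vector_slice[OF assms]
    by (intro arg_cong[where f = sum_list] map_cong refl) fastforce
  finally show ?thesis by (simp add: case_prod_unfold)
qed

lemma invariant_sum_of_squares:
  assumes "unitarizable \<Delta> \<epsilon>"
  obtains n c and y :: "nat \<Rightarrow> 'z" where
    "(\<Sum>k<n. star (y k) * y k) = scal c" "z \<in> cvs.span (y ` {..<n})"
proof -
  obtain n and e :: "nat \<Rightarrow> 'z" and u
    where z: "z \<in> cvs.span (e ` {..<n})" and u: "corep_matrix \<Delta> \<epsilon> n u"
    and e: "\<And>i. i < n \<Longrightarrow> teq (\<alpha> (e i)) (map (\<lambda>j. (u i j, e j)) [0..<n])"
    by (rule subcomodule_basis) blast
  obtain F where F: "posdef n F"
    "\<And>k l. k < n \<Longrightarrow> l < n \<Longrightarrow> (\<Sum>i<n. \<Sum>j<n. F i j *\<^sub>C (star (u i k) * u j l)) = F k l *\<^sub>C 1"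
    by (rule corep_matrix_invariant_form[OF u assms]) blast
  obtain y where y: "herm_form n F e = (\<Sum>k<n. star (y k) * y k)"
    "e ` {..<n} \<subseteq> cvs.span (y ` {..<n})"
    using posdef_herm_form_sum_of_squares[OF F(1)] by blast
  have "Im (\<mu> (herm_form n F e)) = 0" by (simp add: y(1) sum star_self_real)
  then have "\<mu> (herm_form n F e) = complex_of_real (Re (\<mu> (herm_form n F e)))"
    by (simp add: complex_eq_iff)
  moreover have "herm_form n F e = \<mu> (herm_form n F e) *\<^sub>C 1"
    by (rule coinvariant_imp_scalar[OF coinvariant_herm_form[OF e F(2)] clinear mu_one])
  ultimately have "(\<Sum>k<n. star (y k) * y k) = scal (Re (\<mu> (herm_form n F e)))"
    unfolding y(1)[symmetric] scal_def by simp
  moreover have "z \<in> cvs.span (y ` {..<n})"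
    using z cvs.span_minimal[OF y(2) cvs.subspace_span] by blast
  ultimately show ?thesis by (rule that)
qed

lemma subspace_eq_UNIV:
  fixes V :: "'z set"
  assumes "unitarizable \<Delta> \<epsilon>" and V: "cvs.subspace V"
    and squares: "\<And>n c k (y :: nat \<Rightarrow> 'z).
      (\<Sum>k<n. star (y k) * y k) = scal c \<Longrightarrow> k \<in> {..<n} \<Longrightarrow> y k \<in> V"
  shows "V = UNIV"
proof -
  have "z \<in> V" for z
  proof -
    obtain n c and y :: "nat \<Rightarrow> 'z" where y: "(\<Sum>k<n. star (y k) * y k) = scal c"
      "z \<in> cvs.span (y ` {..<n})"
      by (rule invariant_sum_of_squares[OF assms(1)])
    have "y ` {..<n} \<subseteq> V" using squares[OF y(1)] by blast
    with y(2) show ?thesis using cvs.span_minimal[OF _ V] by blast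
  qed
  then show ?thesis by blast
qed

lemma bounded_elements_eq_UNIV: "unitarizable \<Delta> \<epsilon> \<Longrightarrow> bounded_elements = UNIV"
  by (erule subspace_eq_UNIV[OF _ subspace_bounded_elements])
    (rule sum_star_self_bounded_elements[OF finite_lessThan])

lemma uniformly_bounded_elements_eq_UNIV:
  "unitarizable \<Delta> \<epsilon> \<Longrightarrow> (uniformly_bounded_elements :: 'z set) = UNIV"
  by (erule subspace_eq_UNIV[OF _ subspace_uniformly_bounded_elements])
    (rule sum_star_self_uniformly_bounded[OF finite_lessThan])

lemma cstar_norm_gns_opnorm:
  assumes "unitarizable \<Delta> \<epsilon>"
  shows "cstar_norm gns_opnorm"
  unfolding cstar_norm_def
proof (intro conjI allI impI)
  note UNIV = bounded_elements_eq_UNIV[OF assms]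
  show "cstar_seminorm gns_opnorm" by (rule cstar_seminorm_gns_opnorm[OF UNIV])
  fix x assume "gns_opnorm x = 0"
  then have "gns_norm x \<le> 0" using gns_opnorm_bound(1)[of x 1] UNIV by simp
  then show "x = 0" by (intro gns_norm_eq_0_imp_eq_0 antisym gns_norm_nonneg)
qed

end

theorem theorem5p2p1:
  fixes \<Delta> :: "'a::star_alg \<Rightarrow> ('a \<times> 'a) list" and \<epsilon> :: "'a \<Rightarrow> complex" and S :: "'a \<Rightarrow> 'a"
    and \<alpha> :: "'z::star_alg \<Rightarrow> ('a \<times> 'z) list" and \<mu> :: "'z \<Rightarrow> complex"
  assumes "hopf_star_algebra \<Delta> \<epsilon> S"
    and "unitarizable \<Delta> \<epsilon>"
    and "star_galois_extension \<Delta> \<epsilon> \<alpha>"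
    and "haar_measure \<alpha> \<mu>" and "positive_functional \<mu>"
  shows "(\<exists>p :: 'z \<Rightarrow> real. cstar_norm p) \<and>
         (\<forall>z. bdd_above {p z |p :: 'z \<Rightarrow> real. cstar_seminorm p}) \<and>
         cstar_norm (\<lambda>z. SUP p \<in> {p :: 'z \<Rightarrow> real. cstar_seminorm p}. p z)"
proof (intro conjI allI)
  interpret star_galois_haar \<Delta> \<epsilon> S \<alpha> \<mu> using assms by unfold_locales
  have norm: "cstar_norm gns_opnorm" by (rule cstar_norm_gns_opnorm[OF assms(2)])
  then show "\<exists>p :: 'z \<Rightarrow> real. cstar_norm p" by blast
  show bdd: "bdd_above {p z |p :: 'z \<Rightarrow> real. cstar_seminorm p}" for z
    using uniformly_bounded_elements_eq_UNIV[OF assms(2)]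
    by (auto simp: uniformly_bounded_elements_def)
  show "cstar_norm (\<lambda>z. SUP p \<in> {p :: 'z \<Rightarrow> real. cstar_seminorm p}. p z)"
    using norm bdd by (rule cstar_norm_SUP)
qed

end
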